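(* Let $t=t(n)$ and $b=b(n)$, and let $b^* = b^*(n,t) = \max\{n^6/t^4,\; n^{4/3}/t^{2/3}\}$. If $t = \omega(n^{6/5})$ and $b = \omega(b^* )$, then there exists a $(t,b)$-strategy $B$ of Builder such that $$\lim_{n\to\infty} \Pr\big(K_4^- \subseteq B_t\big) = 1,$$ and if $t = o(n^{6/5})$ or $b = o(b^* )$, then for any $(t,b)$-strategy $B$ of Builder, $$\lim_{n\to\infty} \Pr\big(K_4^- \subseteq B_t\big) = 0.$$
   Context: Random graph process with restricted budget: the $N=\binom{n}{2}$ edges of the complete graph $K_n$ on vertex set $[n]$ are put in a uniformly random order $e_1,\dots,e_N$ and revealed one at a time; $G_s$ denotes the graph with edges $e_1,\dots,e_s$. A $(t,b)$-strategy of Builder is an online (deterministic or randomized) rule that, for each $1\le s\le t$, upon seeing $e_s$ and knowing her previous choices, decides irrevocably whether to purchase $e_s$, subject to purchasing at most $b$ edges in total; only the first $t$ edges are revealed. $B_s$ denotes the spanning subgraph of $G_s$ consisting of the edges Builder purchased up to time $s$. $K_4^-$ is the graph on four vertices with five edges ($K_4$ minus one edge). Asymptotic notation is as $n\to\infty$; $f=\omega(g)$ means $f/g\to\infty$ and $f=o(g)$ means $f/g\to 0$. *)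

theory Defs
  imports "HOL-Probability.Probability" "HOL-Combinatorics.Multiset_Permutations"
begin

type_synonym edge = "nat set"

text \<open>A simple graph is a pair of a vertex set and a set of two-element edges.\<close>

type_synonym graph = "nat set \<times> edge set"

definition complete_edges :: "nat \<Rightarrow> edge set" where
  "complete_edges n = {e. e \<subseteq> {1..n} \<and> card e = 2}"

text \<open>Containment of a (not necessarily induced) copy of \<open>H\<close> in \<open>G\<close>.\<close>

definition contains_copy :: "graph \<Rightarrow> graph \<Rightarrow> bool" where
  "contains_copy G H \<longleftrightarrow>
     (\<exists>f. inj_on f (fst H) \<and> f ` fst H \<subseteq> fst G \<and> (\<forall>e\<in>snd H. f ` e \<in> snd G))"

definition K4_minus :: graph where
  "K4_minus = ({1, 2, 3, 4}, {{1, 2}, {1, 3}, {1, 4}, {2, 3}, {2, 4}})"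

text \<open>
  A history lists, in order of appearance, the edges revealed so far, each together with
  Builder's decision (\<open>True\<close> means purchased). A randomized online rule maps the history and the
  newly revealed edge to a distribution on the decision; a deterministic rule
  uses point masses only.
\<close>

type_synonym history = "(edge \<times> bool) list"
type_synonym rule = "history \<Rightarrow> edge \<Rightarrow> bool pmf"

fun play :: "rule \<Rightarrow> history \<Rightarrow> edge list \<Rightarrow> history pmf" where
  "play B h [] = return_pmf h"
| "play B h (e # es) = bind_pmf (B h e) (\<lambda>d. play B (h @ [(e, d)]) es)"

definition process :: "nat \<Rightarrow> nat \<Rightarrow> rule \<Rightarrow> history pmf" where
  "process n t B =
     bind_pmf (pmf_of_set (permutations_of_set (complete_edges n))) (\<lambda>es. play B [] (take t es))"

definition purchased :: "history \<Rightarrow> edge set" where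
  "purchased h = {e. (e, True) \<in> set h}"

definition builder_graph :: "nat \<Rightarrow> history \<Rightarrow> graph" where
  "builder_graph n h = ({1..n}, purchased h)"

definition is_strategy :: "nat \<Rightarrow> nat \<Rightarrow> nat \<Rightarrow> rule \<Rightarrow> bool" where
  "is_strategy n t b B \<longleftrightarrow> (\<forall>h\<in>set_pmf (process n t B). card (purchased h) \<le> b)"

definition prob_K4_minus :: "nat \<Rightarrow> nat \<Rightarrow> rule \<Rightarrow> real" where
  "prob_K4_minus n t B =
     measure_pmf.prob (process n t B) {h. contains_copy (builder_graph n h) K4_minus}"

definition b_star :: "nat \<Rightarrow> nat \<Rightarrow> real" where
  "b_star n t = max (real n ^ 6 / real t ^ 4) (real n powr (4/3) / real t powr (2/3))"

text \<open>
  Asymptotic notation as limits of quotients. With \<open>x / 0 = 0\<close>, an index \<open>n\<close> where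
  \<open>t n = 0\<close> imposes no restriction in \<open>b = o(b_star)\<close>, which matches reading \<open>b_star n 0\<close>
  as infinity; membership in the library's \<open>o(_)\<close> would force \<open>b n = 0\<close> at such (large) \<open>n\<close>.
\<close>

definition little_omega :: "(nat \<Rightarrow> real) \<Rightarrow> (nat \<Rightarrow> real) \<Rightarrow> bool" where
  "little_omega f g \<longleftrightarrow> filterlim (\<lambda>n. f n / g n) at_top sequentially"

definition little_o :: "(nat \<Rightarrow> real) \<Rightarrow> (nat \<Rightarrow> real) \<Rightarrow> bool" where
  "little_o f g \<longleftrightarrow> (\<lambda>n. f n / g n) \<longlonglongrightarrow> 0"

end

theory Submission
  imports Defs "HOL-Probability.Random_Permutations"
begin

text \<open>
  Write \<open>p\<close> for the fraction of edges that is revealed. In the negative direction, let \<open>a S\<close> be the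
  probability that Builder buys all edges of \<open>S\<close>. The edge of \<open>S\<close> bought last was still unrevealed
  when the others had been bought, so \<open>a S\<close> is at most \<open>p\<close> times the sum of the \<open>a (S - {e})\<close>.
  Peeling off edges of a copy in this way, and bounding the number of partial copies by the budget
  as soon as this is cheaper than waiting, the success probability is at most a constant times each
  of \<open>n^4 p^5\<close>, \<open>b n^2 p^4\<close> and \<open>b^3 p^2\<close>.

  In the positive direction Builder fixes \<open>k\<close> centers and \<open>r\<close> further vertices. In the first half she
  buys every edge from a center to a further vertex; in the second half she buys every edge that
  closes a triangle with a center. Two such edges sharing a vertex in the same star form the desired
  graph. A second moment computation shows that this happens once \<open>k r^3 p^5\<close> is large, and Markov's
  inequality bounds the money spent by \<open>k r p + k r^2 p^3\<close>. If \<open>t\<close> is large, \<open>k = 1\<close> and \<open>r\<close> of order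
  \<open>p^(-5/3)\<close> suffice; otherwise \<open>r = n / 2\<close> and \<open>k\<close> is of order \<open>1 / (n^3 p^5)\<close>.
\<close>

section \<open>Random orders of a finite set\<close>

text \<open>Since \<open>p\<close> has order \<open>t / n^2\<close>, the three negative bounds have
  orders \<open>t^5 / n^6\<close>, \<open>b t^4 / n^6\<close> and \<open>b^3 t^2 / n^4\<close>:
  powers of \<open>t / n^(6/5)\<close> and of \<open>b\<close> divided by either term of
  \<open>b_star\<close>. The obstacle there is adaptivity. Purchases depend on everything seen so
  far and are not independent, so the peeling uses nothing but the uniformity of the still hidden
  edges and holds for every rule. In the positive direction a star with \<open>r\<close> leaves
  produces about \<open>r^3 p^5\<close> copies. A single star therefore needs \<open>r\<close> of
  order \<open>p^(-5/3)\<close> and costs \<open>r p = p^(-2/3)\<close>, the second term of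
  \<open>b_star\<close>. When so many leaves do not exist, a star on about \<open>n\<close> leaves
  gives \<open>n^3 p^5\<close> copies and costs \<open>n p\<close>, so \<open>1 / (n^3 p^5)\<close>
  stars cost \<open>1 / (n^2 p^4)\<close>, the first term. The two phases make the purchases a
  function of the order alone, so every probability becomes a count of permutations that place given
  edges in two given windows.\<close>

lemma sum_permutations_of_set_Cons:
  fixes f :: "'a list \<Rightarrow> 'b::comm_monoid_add"
  assumes "finite E" "E \<noteq> {}"
  shows "(\<Sum>es\<in>permutations_of_set E. f es) =
           (\<Sum>x\<in>E. \<Sum>es\<in>permutations_of_set (E - {x}). f (x # es))"
proof -
  have "(\<Sum>es\<in>permutations_of_set E. f es) = (\<Sum>x\<in>E. \<Sum>es\<in>(#) x ` permutations_of_set (E - {x}). f es)"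
    unfolding permutations_of_set_nonempty[OF assms(2)]
    using assms by (intro sum.UNION_disjoint) auto
  also have "\<dots> = (\<Sum>x\<in>E. \<Sum>es\<in>permutations_of_set (E - {x}). f (x # es))"
    by (rule sum.cong[OF refl], subst sum.reindex) (auto simp: inj_on_def)
  finally show ?thesis .
qed

text \<open>The two consecutive windows model the two phases of the strategy; with
  \<open>m2 = 0\<close> and \<open>B = {}\<close> the single window of the negative direction is
  recovered.\<close>

definition placements :: "'a set \<Rightarrow> nat \<Rightarrow> nat \<Rightarrow> 'a set \<Rightarrow> 'a set \<Rightarrow> 'a list set" where
  "placements E m1 m2 A B =
     {es \<in> permutations_of_set E. A \<subseteq> set (take m1 es) \<and> B \<subseteq> set (take m2 (drop m1 es))}"

lemma card_placements_rec:
  assumes "finite E" "E \<noteq> {}"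
  shows "card (placements E m1 m2 A B) =
    (\<Sum>x\<in>E. card {es \<in> permutations_of_set (E - {x}).
        A \<subseteq> set (take m1 (x # es)) \<and> B \<subseteq> set (take m2 (drop m1 (x # es)))})"
proof -
  have "card (placements E m1 m2 A B) = (\<Sum>es\<in>permutations_of_set E.
      if A \<subseteq> set (take m1 es) \<and> B \<subseteq> set (take m2 (drop m1 es)) then 1 else 0)"
    by (simp add: placements_def sum.If_cases Int_def)
  also have "\<dots> = (\<Sum>x\<in>E. card {es \<in> permutations_of_set (E - {x}).
        A \<subseteq> set (take m1 (x # es)) \<and> B \<subseteq> set (take m2 (drop m1 (x # es)))})"
    unfolding sum_permutations_of_set_Cons[OF assms]
    by (simp add: sum.If_cases Int_def)
  finally show ?thesis .
qed

lemma sum_split_three: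
  fixes f :: "'a \<Rightarrow> nat"
  assumes "finite E" "A \<subseteq> E" "B \<subseteq> E" "A \<inter> B = {}"
    and "\<And>x. x \<in> A \<Longrightarrow> f x = u" "\<And>x. x \<in> B \<Longrightarrow> f x = v" "\<And>x. x \<in> E - A - B \<Longrightarrow> f x = w"
  shows "(\<Sum>x\<in>E. f x) = card A * u + card B * v + (card E - card A - card B) * w"
proof -
  have fin: "finite A" "finite B" using assms finite_subset by auto
  have "E = A \<union> B \<union> (E - A - B)" using assms by blast
  hence "sum f E = sum f (A \<union> B \<union> (E - A - B))" by simp
  also have "\<dots> = sum f A + sum f B + sum f (E - A - B)"
    using assms fin by (subst sum.union_disjoint; auto)+
  also have "sum f A = card A * u" using assms by simp
  also have "sum f B = card B * v" using assms by simp
  also have "sum f (E - A - B) = card (E - A - B) * w" using assms by simp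
  also have "card (E - A - B) = card E - card A - card B"
  proof -
    have "B \<subseteq> E - A" using assms by blast
    thus ?thesis using assms fin by (simp add: card_Diff_subset)
  qed
  finally show ?thesis .
qed

text \<open>Pascal's rule, split by whether the first element lies in the \<open>a\<close>-set. If
  \<open>N = a + s\<close>, truncated subtraction spoils the second summand, and \<open>nz\<close>
  makes it vanish: a full second window (\<open>Y\<close> nonzero) leaves fewer than
  \<open>a\<close> further places in the first.\<close>

lemma pascal_step:
  fixes a s N Y :: nat
  assumes "N \<ge> 1" "a + s \<le> N" and nz: "N = a + s \<Longrightarrow> Y \<noteq> 0 \<Longrightarrow> m < a"
  shows "a * (fact (a - 1) * (m choose (a - 1)) * Y * fact (N - 1 - (a - 1) - s)) +
     (N - a - s) * (fact a * (m choose a) * Y * fact (N - 1 - a - s))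
     = fact a * (Suc m choose a) * Y * fact (N - a - s)"
proof -
  have 2: "(N - a - s) * (fact a * (m choose a) * Y * fact (N - 1 - a - s)) = fact a * (m choose a) * Y * fact (N - a - s)"
  proof (cases "N = a + s")
    case True thus ?thesis using nz by (cases "Y = 0") (auto simp: binomial_eq_0)
  next
    case False
    hence "N - a - s = Suc (N - 1 - a - s)" using assms by simp
    hence "fact (N - a - s) = (N - a - s) * (fact (N - 1 - a - s)::nat)" by simp
    thus ?thesis by (simp add: algebra_simps)
  qed
  show ?thesis
  proof (cases a)
    case 0 thus ?thesis using 2 by simp
  next
    case (Suc a')
    have "N - 1 - (a - 1) - s = N - a - s" using Suc assms by simp
    thus ?thesis unfolding 2 using Suc by (simp add: algebra_simps)
  qed
qed

text \<open>The three cases for the first element of the permutation reproduce Pascal's rule.\<close>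

lemma card_placements:
  assumes "finite E" "A \<subseteq> E" "B \<subseteq> E" "A \<inter> B = {}" "m1 + m2 \<le> card E"
  shows "card (placements E m1 m2 A B) = fact (card A) * (m1 choose card A) *
           (fact (card B) * (m2 choose card B)) * fact (card E - card A - card B)"
  using assms
proof (induction "card E" arbitrary: E A B m1 m2)
  case 0
  hence "E = {}" by simp
  thus ?case using 0 by (auto simp: placements_def)
next
  case (Suc N)
  have fin: "finite A" "finite B" using Suc.prems(1-3) by (auto intro: finite_subset)
  have ne: "E \<noteq> {}" using Suc by auto
  have cN: "card E = Suc N" using Suc by simp
  have cAB: "card A + card B \<le> card E"
    using Suc.prems fin by (metis card_Un_disjoint card_mono Un_least)
  have cE: "card (E - {x}) = N" if "x \<in> E" for x using that Suc by simp
  have IH: "card (placements E' m1 m2 A B) = fact (card A) * (m1 choose card A) *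
           (fact (card B) * (m2 choose card B)) * fact (N - card A - card B)"
    if "card E' = N" "finite E'" "A \<subseteq> E'" "B \<subseteq> E'" "A \<inter> B = {}" "m1 + m2 \<le> N" for E' A B :: "'a set" and m1 m2
    using Suc.hyps(1)[of E' A B m1 m2] that by simp
  let ?t = "\<lambda>x. card {es \<in> permutations_of_set (E - {x}).
        A \<subseteq> set (take m1 (x # es)) \<and> B \<subseteq> set (take m2 (drop m1 (x # es)))}"
  have setE: "set es = E - {x}" if "es \<in> permutations_of_set (E - {x})" for x es
    using that by (auto dest: permutations_of_setD)
  show ?case
  proof (cases m1)
    case (Suc m)
    have tA: "?t x = fact (card A - 1) * (m choose (card A - 1)) *
           (fact (card B) * (m2 choose card B)) * fact (N - (card A - 1) - card B)" if x: "x \<in> A" for x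
    proof -
      have "?t x = card (placements (E - {x}) m m2 (A - {x}) B)"
        unfolding placements_def \<open>m1 = Suc m\<close> by (rule arg_cong[where f = card]) auto
      also have "\<dots> = fact (card A - 1) * (m choose (card A - 1)) *
           (fact (card B) * (m2 choose card B)) * fact (N - (card A - 1) - card B)"
        using x Suc.prems cN cE[of x] fin \<open>m1 = Suc m\<close> by (subst IH) auto
      finally show ?thesis .
    qed
    \<comment> \<open>The first position belongs to the first window, so an element of
      \<open>B\<close> there can no longer appear in the second.\<close>
    have tB: "?t x = 0" if x: "x \<in> B" for x
      using x setE[of _ x] Suc.prems \<open>m1 = Suc m\<close>
      by (auto dest!: set_take_subset[THEN subsetD] set_drop_subset[THEN subsetD] subsetD)
    have tC: "?t x = fact (card A) * (m choose card A) *
           (fact (card B) * (m2 choose card B)) * fact (N - card A - card B)" if x: "x \<in> E - A - B" for x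
    proof -
      have "?t x = card (placements (E - {x}) m m2 A B)"
        unfolding placements_def \<open>m1 = Suc m\<close> using x by (intro arg_cong[where f = card]) auto
      also have "\<dots> = fact (card A) * (m choose card A) *
           (fact (card B) * (m2 choose card B)) * fact (N - card A - card B)"
        using x Suc.prems cN cE[of x] fin \<open>m1 = Suc m\<close> by (subst IH) auto
      finally show ?thesis .
    qed
    let ?Y = "fact (card B) * (m2 choose card B)"
    have "card (placements E m1 m2 A B) = sum ?t E"
      by (rule card_placements_rec[OF \<open>finite E\<close> ne])
    also have "\<dots> = card A * (fact (card A - 1) * (m choose (card A - 1)) * ?Y * fact (card E - 1 - (card A - 1) - card B))
       + (card E - card A - card B) * (fact (card A) * (m choose card A) * ?Y * fact (card E - 1 - card A - card B))"
      using sum_split_three[OF \<open>finite E\<close> \<open>A \<subseteq> E\<close> \<open>B \<subseteq> E\<close> \<open>A \<inter> B = {}\<close> tA tB tC] cN by simp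
    also have "\<dots> = fact (card A) * (Suc m choose card A) * ?Y * fact (card E - card A - card B)"
      using cAB cN Suc.prems \<open>m1 = Suc m\<close> by (intro pascal_step) auto
    finally show ?thesis using \<open>m1 = Suc m\<close> by simp
  next
    \<comment> \<open>An empty first window gives count zero unless \<open>A = {}\<close>. In that
      case the recursion consumes the second window, with \<open>pascal_step\<close> at
      \<open>s = 0\<close> and \<open>Y = 1\<close>.\<close>
    case 0
    show ?thesis
    proof (cases "A = {}")
      case False
      hence "card A > 0" using fin by (simp add: card_gt_0_iff)
      thus ?thesis using \<open>m1 = 0\<close> False by (simp add: placements_def)
    next
      case True
      show ?thesis
      proof (cases m2)
        case 0
        thus ?thesis using \<open>A = {}\<close> \<open>m1 = 0\<close> fin cN Suc.prems
          by (cases "B = {}") (auto simp: placements_def card_gt_0_iff binomial_eq_0)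
      next
        case (Suc m)
        have tB: "?t x = fact (card B - 1) * (m choose (card B - 1)) * 1 * fact (N - (card B - 1))" if x: "x \<in> B" for x
        proof -
          have "?t x = card (placements (E - {x}) 0 m {} (B - {x}))"
            unfolding placements_def \<open>m1 = 0\<close> \<open>m2 = Suc m\<close> \<open>A = {}\<close> by (rule arg_cong[where f = card]) auto
          also have "\<dots> = fact (card B - 1) * (m choose (card B - 1)) * 1 * fact (N - (card B - 1))"
            using x Suc.prems cN cE[of x] fin \<open>m2 = Suc m\<close> by (subst IH) auto
          finally show ?thesis .
        qed
        have tC: "?t x = fact (card B) * (m choose card B) * 1 * fact (N - card B)" if x: "x \<in> E - {} - B" for x
        proof -
          have "?t x = card (placements (E - {x}) 0 m {} B)"
            unfolding placements_def \<open>m1 = 0\<close> \<open>m2 = Suc m\<close> \<open>A = {}\<close> using x by (intro arg_cong[where f = card]) auto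
          also have "\<dots> = fact (card B) * (m choose card B) * 1 * fact (N - card B)"
            using x Suc.prems cN cE[of x] fin \<open>m2 = Suc m\<close> by (subst IH) auto
          finally show ?thesis .
        qed
        have "card (placements E m1 m2 A B) = sum ?t E"
          by (rule card_placements_rec[OF \<open>finite E\<close> ne])
        also have "\<dots> = card B * (fact (card B - 1) * (m choose (card B - 1)) * 1 * fact (card E - 1 - (card B - 1) - 0))
           + (card E - card B - 0) * (fact (card B) * (m choose card B) * 1 * fact (card E - 1 - card B - 0))"
          using sum_split_three[OF \<open>finite E\<close> _ \<open>B \<subseteq> E\<close> _ _ tB tC, of "{}"] cN by simp
        also have "\<dots> = fact (card B) * (Suc m choose card B) * 1 * fact (card E - card B - 0)"
          using cAB cN Suc.prems \<open>m2 = Suc m\<close> by (intro pascal_step) auto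
        finally show ?thesis using \<open>m1 = 0\<close> \<open>m2 = Suc m\<close> \<open>A = {}\<close> by simp
      qed
    qed
  qed
qed

lemma prob_mem_take_permutation:
  assumes "finite E" "m \<le> card E" "e \<in> E"
  shows "measure_pmf.prob (pmf_of_set (permutations_of_set E)) {es. e \<in> set (take m es)} = real m / real (card E)"
proof -
  have ce: "card E > 0" using assms by (auto simp: card_gt_0_iff)
  have "measure_pmf.prob (pmf_of_set (permutations_of_set E)) {es. e \<in> set (take m es)}
      = card (placements E m 0 {e} {}) / fact (card E)"
    using assms by (subst measure_pmf_of_set)
      (auto simp: placements_def intro!: arg_cong[where f = card])
  also have "card (placements E m 0 {e} {}) = m * fact (card E - 1)"
    using card_placements[of E "{e}" "{}" m 0] assms by simp
  also have "(fact (card E) :: real) = card E * fact (card E - 1)"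
    using ce by (cases "card E") (auto simp: algebra_simps)
  finally show ?thesis using ce by simp
qed

lemma fact_times_binomial_le: "fact a * (m choose a) \<le> (m::nat) ^ a"
proof (cases "a \<le> m")
  case True
  have "fact a * (m choose a) = fact m div fact (m - a)"
    by (metis True binomial_fact_lemma fact_nonzero mult.commute mult.assoc nonzero_mult_div_cancel_right)
  also have "\<dots> \<le> m ^ a" using True by (rule fact_div_fact_le_pow)
  finally show ?thesis .
qed (simp add: binomial_eq_0)

text \<open>Each of the top \<open>j\<close> factors of \<open>fact N\<close> is at least
  \<open>N - r\<close>. One base thus serves all exponents up to \<open>r\<close>.\<close>

lemma fact_diff_le:
  assumes "j \<le> r" "r \<le> N"
  shows "(fact (N - j) :: real) * (real N - real r) ^ j \<le> fact N"
  using assms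
proof (induction j)
  case (Suc j)
  have "(fact (N - Suc j) :: real) * (real N - real r) ^ Suc j
     = fact (N - Suc j) * (real N - real r) * (real N - real r) ^ j" by simp
  also have "\<dots> \<le> (fact (N - Suc j) * (real N - real j)) * (real N - real r) ^ j"
    using Suc by (intro mult_right_mono mult_left_mono) auto
  also have "fact (N - Suc j) * (real N - real j) = fact (N - j)"
  proof -
    have "N - j = Suc (N - Suc j)" using Suc.prems by simp
    thus ?thesis using Suc.prems by (simp only: fact_Suc) (simp add: of_nat_diff)
  qed
  finally show ?case using Suc by simp
qed simp

section \<open>Revealing one edge at a time\<close>

definition revealed :: "history \<Rightarrow> edge set" where
  "revealed h = fst ` set h"

lemma purchased_append [simp]: "purchased (h @ h') = purchased h \<union> purchased h'"
  by (auto simp: purchased_def)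

lemma purchased_Nil [simp]: "purchased [] = {}"
  by (simp add: purchased_def)

lemma revealed_append [simp]: "revealed (h @ h') = revealed h \<union> revealed h'"
  by (auto simp: revealed_def)

lemma revealed_Nil [simp]: "revealed [] = {}"
  by (simp add: revealed_def)

lemma revealed_Cons [simp]: "revealed (x # h) = insert (fst x) (revealed h)"
  by (simp add: revealed_def)

lemma purchased_subset_revealed: "purchased h \<subseteq> revealed h"
  by (force simp: purchased_def revealed_def)

lemma finite_purchased [simp]: "finite (purchased h)"
  by (rule finite_subset[OF purchased_subset_revealed]) (simp add: revealed_def)

text \<open>The game resumed at an arbitrary history, with \<open>A\<close> in the role of the
  unrevealed edges; this generality is what induction over single revelations needs.\<close>

definition continue :: "rule \<Rightarrow> nat \<Rightarrow> edge set \<Rightarrow> history \<Rightarrow> history pmf" where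
  "continue B m A h = bind_pmf (pmf_of_set (permutations_of_set A)) (\<lambda>es. play B h (take m es))"

lemma process_eq_continue: "process n t B = continue B t (complete_edges n) []"
  by (simp add: process_def continue_def)

lemma continue_0: "continue B 0 A h = return_pmf h"
  by (simp add: continue_def)

lemma continue_empty: "continue B m {} h = return_pmf h"
  by (simp add: continue_def pmf_of_set_singleton bind_return_pmf)

lemma continue_Suc:
  assumes "finite A" "A \<noteq> {}"
  shows "continue B (Suc m) A h =
    bind_pmf (pmf_of_set A) (\<lambda>e. bind_pmf (B h e) (\<lambda>d. continue B m (A - {e}) (h @ [(e, d)])))"
proof -
  have "continue B (Suc m) A h = bind_pmf (pmf_of_set A) (\<lambda>e.
     bind_pmf (pmf_of_set (permutations_of_set (A - {e}))) (\<lambda>es. bind_pmf (B h e) (\<lambda>d. play B (h @ [(e, d)]) (take m es))))"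
    by (simp add: continue_def random_permutation_of_set[OF assms] bind_assoc_pmf bind_return_pmf)
  also have "\<dots> = bind_pmf (pmf_of_set A) (\<lambda>e. bind_pmf (B h e) (\<lambda>d. continue B m (A - {e}) (h @ [(e, d)])))"
    unfolding continue_def by (subst bind_commute_pmf) simp
  finally show ?thesis .
qed

lemma set_pmf_play:
  "h' \<in> set_pmf (play B h es) \<Longrightarrow> \<exists>r. h' = h @ r \<and> map fst r = es"
proof (induction es arbitrary: h)
  case (Cons e es)
  then obtain d where "h' \<in> set_pmf (play B (h @ [(e, d)]) es)" by auto
  from Cons.IH[OF this] show ?case by auto
qed simp

lemma set_pmf_continue:
  assumes "h' \<in> set_pmf (continue B m A h)" "finite A"
  shows "\<exists>r es. h' = h @ r \<and> es \<in> permutations_of_set A \<and> map fst r = take m es"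
  using assms by (force simp: continue_def dest!: set_pmf_play)

lemma set_pmf_process:
  assumes "h \<in> set_pmf (process n t B)" "finite (complete_edges n)"
  shows "distinct (map fst h)" "purchased h \<subseteq> complete_edges n"
proof -
  obtain es where es: "es \<in> permutations_of_set (complete_edges n)" "map fst h = take t es"
    using set_pmf_continue[OF assms(1)[unfolded process_eq_continue] assms(2)] by auto
  show "distinct (map fst h)" using es by (auto dest: permutations_of_setD)
  have "revealed h = set (map fst h)" by (simp add: revealed_def)
  also have "\<dots> \<subseteq> complete_edges n" using es by (auto dest: permutations_of_setD in_set_takeD)
  finally show "purchased h \<subseteq> complete_edges n" using purchased_subset_revealed by blast
qed

text \<open>Decisions influence what is bought, never what is revealed; here the rule drops out and
  only the random order remains.\<close>

lemma map_pmf_revealed_play: "map_pmf revealed (play B h es) = return_pmf (revealed h \<union> set es)"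
proof (induction es arbitrary: h)
  case (Cons e es)
  show ?case by (simp add: map_bind_pmf Cons.IH)
qed simp

lemma emeasure_revealed_continue:
  fixes p :: real
  assumes "finite A" "real m \<le> p * card A" "p \<le> 1" "e \<notin> revealed h" "p \<ge> 0"
  shows "emeasure (continue B m A h) {h'. e \<in> revealed h'} \<le> ennreal p"
proof -
  have "emeasure (continue B m A h) {h'. e \<in> revealed h'}
     = emeasure (map_pmf revealed (continue B m A h)) {R. e \<in> R}"
    by (simp add: vimage_def)
  also have "map_pmf revealed (continue B m A h)
     = map_pmf (\<lambda>es. revealed h \<union> set (take m es)) (pmf_of_set (permutations_of_set A))"
    by (simp add: continue_def map_bind_pmf map_pmf_revealed_play) (simp add: map_pmf_def)
  also have "emeasure \<dots> {R. e \<in> R} = emeasure (pmf_of_set (permutations_of_set A)) {es. e \<in> set (take m es)}"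
    using assms by (simp add: vimage_def)
  also have "\<dots> \<le> ennreal p"
  proof (cases "e \<in> A")
    case True
    have c: "card A > 0" using True assms by (auto simp: card_gt_0_iff)
    have "p * real (card A) \<le> 1 * real (card A)" using assms by (intro mult_right_mono) auto
    hence "m \<le> card A" using assms by simp
    hence "measure_pmf.prob (pmf_of_set (permutations_of_set A)) {es. e \<in> set (take m es)} = real m / real (card A)"
      using True assms by (intro prob_mem_take_permutation) auto
    also have "\<dots> \<le> p" using assms c by (simp add: field_simps)
    finally show ?thesis by (simp add: measure_pmf.emeasure_eq_measure ennreal_leI)
  next
    case False
    hence "permutations_of_set A \<inter> {es. e \<in> set (take m es)} = {}"
      by (auto dest: permutations_of_setD in_set_takeD)
    thus ?thesis using assms by (simp add: emeasure_pmf_of_set)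
  qed
  finally show ?thesis .
qed

text \<open>The split into \<open>h1\<close> and \<open>h2\<close> replaces a stopping time: at some
  moment all of \<open>T\<close> was bought and \<open>e\<close> was still hidden.\<close>

definition revealed_after :: "edge set \<Rightarrow> edge \<Rightarrow> history \<Rightarrow> bool" where
  "revealed_after T e h \<longleftrightarrow> (\<exists>h1 h2. h = h1 @ h2 \<and> T \<subseteq> purchased h1 \<and> e \<notin> revealed h1 \<and> e \<in> revealed h2)"

lemma revealed_after_imp: "revealed_after T e h \<Longrightarrow> T \<subseteq> purchased h \<and> e \<in> revealed h"
  by (auto simp: revealed_after_def)

text \<open>As \<open>T\<close> is already bought, the event on the right has probability one, and
  only the appearance of the hidden edge \<open>e\<close> is left to bound.\<close>

lemma emeasure_revealed_after_start:
  fixes p :: real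
  assumes "finite A" "real m \<le> p * card A" "p \<le> 1" "p \<ge> 0" "e \<notin> revealed h" "T \<subseteq> purchased h"
  shows "emeasure (continue B m A h) {h'. revealed_after T e h'}
    \<le> ennreal p * emeasure (continue B m A h) {h'. T \<subseteq> purchased h'}"
proof -
  have "emeasure (continue B m A h) {h'. revealed_after T e h'} \<le> emeasure (continue B m A h) {h'. e \<in> revealed h'}"
    by (rule emeasure_mono) (auto dest: revealed_after_imp)
  also have "\<dots> \<le> ennreal p" using assms by (intro emeasure_revealed_continue) auto
  also have "emeasure (continue B m A h) {h'. T \<subseteq> purchased h'} = 1"
    using assms by (subst measure_pmf.emeasure_eq_1_AE) (auto simp: AE_measure_pmf_iff dest!: set_pmf_continue)
  hence "ennreal p = ennreal p * emeasure (continue B m A h) {h'. T \<subseteq> purchased h'}" by simp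
  finally show ?thesis .
qed

text \<open>Induction up to the first moment at which \<open>T\<close> is complete. If
  \<open>e\<close> is hidden then, \<open>emeasure_revealed_after_start\<close> takes over; if not,
  the left event has become impossible.\<close>

lemma emeasure_revealed_after:
  fixes p :: real
  assumes "finite A" "real m \<le> p * card A" "p \<le> 1" "p \<ge> 0" "\<not> T \<subseteq> purchased h"
  shows "emeasure (continue B m A h) {h'. revealed_after T e h'}
    \<le> ennreal p * emeasure (continue B m A h) {h'. T \<subseteq> purchased h'}"
  using assms
proof (induction m arbitrary: A h)
  case 0
  thus ?case by (auto simp: continue_0 indicator_def dest: revealed_after_imp)
next
  case (Suc m)
  show ?case
  proof (cases "A = {}")
    case True
    thus ?thesis using Suc.prems by (auto simp: continue_empty indicator_def dest: revealed_after_imp)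
  next
    case False
    have step: "emeasure (continue B m (A - {x}) (h @ [(x, d)])) {h'. revealed_after T e h'}
      \<le> ennreal p * emeasure (continue B m (A - {x}) (h @ [(x, d)])) {h'. T \<subseteq> purchased h'}"
      if x: "x \<in> A" for x d
    proof -
      have "card A = Suc (card (A - {x}))" using x Suc.prems card_Suc_Diff1[of A x] by simp
      \<comment> \<open>The density invariant survives a revelation: the left side drops by 1, the
        right side by \<open>p \<le> 1\<close>.\<close>
      hence c: "real m \<le> p * card (A - {x})" using Suc.prems by (simp add: algebra_simps)
      show ?thesis
      proof (cases "T \<subseteq> purchased (h @ [(x, d)])")
        case False
        thus ?thesis using Suc.prems c by (intro Suc.IH) auto
      next
        case T: True
        show ?thesis
        proof (cases "e \<in> revealed (h @ [(x, d)])")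
          case False
          thus ?thesis using Suc.prems c T by (intro emeasure_revealed_after_start) auto
        next
          case True
          \<comment> \<open>A witnessing \<open>h1\<close> either is a prefix of \<open>h\<close>,
            where \<open>T\<close> is incomplete, or extends the present history, where
            \<open>e\<close> is already revealed.\<close>
          have no: "\<not> revealed_after T e ((h @ [(x, d)]) @ r)" for r
          proof
            assume "revealed_after T e ((h @ [(x, d)]) @ r)"
            then obtain h1 h2 where h: "(h @ [(x, d)]) @ r = h1 @ h2" "T \<subseteq> purchased h1" "e \<notin> revealed h1"
              by (auto simp: revealed_after_def)
            have "(\<exists>us. h @ [(x, d)] = h1 @ us \<and> us \<noteq> []) \<or> (\<exists>us. h1 = (h @ [(x, d)]) @ us)"
              using h(1) append_eq_append_conv2[of "h @ [(x, d)]" r h1 h2] by (metis append_Nil2)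
            thus False
            proof
              assume "\<exists>us. h @ [(x, d)] = h1 @ us \<and> us \<noteq> []"
              then obtain us where "h @ [(x, d)] = h1 @ us" "us \<noteq> []" by blast
              hence "h = h1 @ butlast us" by (metis butlast_append butlast_snoc)
              thus False using h(2) Suc.prems by auto
            next
              assume "\<exists>us. h1 = (h @ [(x, d)]) @ us"
              thus False using h(3) True by auto
            qed
          qed
          have "emeasure (continue B m (A - {x}) (h @ [(x, d)])) {h'. revealed_after T e h'} = 0"
            using no Suc.prems
            by (auto simp: measure_pmf.emeasure_eq_measure measure_pmf_zero_iff dest!: set_pmf_continue)
          thus ?thesis by simp
        qed
      qed
    qed
    have "emeasure (continue B (Suc m) A h) {h'. revealed_after T e h'}
      = (\<integral>\<^sup>+x. \<integral>\<^sup>+d. emeasure (continue B m (A - {x}) (h @ [(x, d)])) {h'. revealed_after T e h'} \<partial>B h x \<partial>pmf_of_set A)"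
      using False Suc.prems by (simp add: continue_Suc)
    also have "\<dots> \<le> (\<integral>\<^sup>+x. \<integral>\<^sup>+d. ennreal p * emeasure (continue B m (A - {x}) (h @ [(x, d)])) {h'. T \<subseteq> purchased h'} \<partial>B h x \<partial>pmf_of_set A)"
      using step False Suc.prems by (intro nn_integral_mono_AE) (auto simp: AE_measure_pmf_iff intro!: nn_integral_mono)
    also have "\<dots> = ennreal p * emeasure (continue B (Suc m) A h) {h'. T \<subseteq> purchased h'}"
      using False Suc.prems by (simp add: continue_Suc nn_integral_cmult)
    finally show ?thesis .
  qed
qed

text \<open>The witness is the edge whose purchase completes \<open>S\<close>. Distinctness of the
  revealed edges ensures that it was still hidden before.\<close>

lemma exists_last_purchase:
  assumes "S \<subseteq> purchased h" "S \<noteq> {}" "distinct (map fst h)"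
  shows "\<exists>e\<in>S. revealed_after (S - {e}) e h"
  using assms
proof (induction h rule: rev_induct)
  case (snoc y h)
  obtain x d where y: "y = (x, d)" by force
  show ?case
  proof (cases "S \<subseteq> purchased h")
    case True
    then obtain e h1 h2 where "e \<in> S" "h = h1 @ h2" "S - {e} \<subseteq> purchased h1" "e \<notin> revealed h1" "e \<in> revealed h2"
      using snoc by (auto simp: revealed_after_def)
    hence "revealed_after (S - {e}) e (h @ [y])"
      unfolding revealed_after_def by (intro exI[of _ h1] exI[of _ "h2 @ [y]"]) auto
    thus ?thesis using \<open>e \<in> S\<close> by blast
  next
    case False
    have "purchased [y] \<subseteq> {x}" using y by (auto simp: purchased_def)
    hence "S - {x} \<subseteq> purchased h" "x \<in> S" using False snoc.prems by auto
    moreover have "x \<notin> revealed h" using snoc.prems y by (auto simp: revealed_def)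
    ultimately have "revealed_after (S - {x}) x (h @ [y])"
      unfolding revealed_after_def using y by (intro exI[of _ h] exI[of _ "[y]"]) auto
    thus ?thesis using \<open>x \<in> S\<close> by blast
  qed
qed simp

definition prob_purchase :: "nat \<Rightarrow> nat \<Rightarrow> rule \<Rightarrow> edge set \<Rightarrow> real" where
  "prob_purchase n t B S = measure_pmf.prob (process n t B) {h. S \<subseteq> purchased h}"

text \<open>Conditioning on which edge of \<open>S\<close> is bought last: it was still unrevealed, hence shows up in
  the remaining time with probability at most \<open>p\<close>, once all other edges of \<open>S\<close> were bought.\<close>

lemma prob_purchase_le_sum:
  fixes p :: real
  assumes "finite (complete_edges n)" "real t \<le> p * card (complete_edges n)" "p \<le> 1" "0 \<le> p"
    and "finite S" "S \<noteq> {}"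
  shows "prob_purchase n t B S \<le> p * (\<Sum>e\<in>S. prob_purchase n t B (S - {e}))"
proof -
  let ?M = "process n t B"
  have one: "measure_pmf.prob ?M {h. revealed_after (S - {e}) e h} \<le> p * prob_purchase n t B (S - {e})" for e
  proof -
    \<comment> \<open>For a singleton \<open>S\<close> the set \<open>S - {e}\<close> is empty and
      counts as bought from the outset, so the start lemma applies directly.\<close>
    have "emeasure ?M {h. revealed_after (S - {e}) e h} \<le> ennreal p * emeasure ?M {h. S - {e} \<subseteq> purchased h}"
      unfolding process_eq_continue using assms
      by (cases "S - {e} \<subseteq> {}") (intro emeasure_revealed_after_start emeasure_revealed_after; simp; fail)+
    thus ?thesis
      using assms by (simp add: measure_pmf.emeasure_eq_measure prob_purchase_def flip: ennreal_mult)
  qed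
  have "prob_purchase n t B S \<le> measure_pmf.prob ?M (\<Union>e\<in>S. {h. revealed_after (S - {e}) e h})"
    unfolding prob_purchase_def using assms exists_last_purchase set_pmf_process(1)
    by (intro measure_pmf.finite_measure_mono_AE) (auto simp: AE_measure_pmf_iff)
  also have "\<dots> \<le> (\<Sum>e\<in>S. measure_pmf.prob ?M {h. revealed_after (S - {e}) e h})"
    using assms by (intro measure_pmf.finite_measure_subadditive_finite) auto
  also have "\<dots> \<le> (\<Sum>e\<in>S. p * prob_purchase n t B (S - {e}))" by (intro sum_mono one)
  finally show ?thesis by (simp add: sum_distrib_left)
qed

section \<open>Expected number of purchased copies\<close>

lemma finite_complete_edges [simp]: "finite (complete_edges n)"
  by (rule finite_subset[of _ "Pow {1..n}"]) (auto simp: complete_edges_def)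

lemma card_complete_edges: "card (complete_edges n) = n choose 2"
  using n_subsets[of "{1..n}" 2] by (simp add: complete_edges_def)

lemma sum_prob_eq_expectation_card:
  fixes M :: "'a pmf"
  assumes "finite I"
  shows "(\<Sum>i\<in>I. measure_pmf.prob M {h. P i h}) = measure_pmf.expectation M (\<lambda>h. real (card {i\<in>I. P i h}))"
proof -
  have "(\<Sum>i\<in>I. measure_pmf.prob M {h. P i h}) = (\<Sum>i\<in>I. measure_pmf.expectation M (indicat_real {h. P i h}))"
    by simp
  also have "\<dots> = measure_pmf.expectation M (\<lambda>h. \<Sum>i\<in>I. indicat_real {h. P i h} h)"
    by (rule Bochner_Integration.integral_sum[symmetric]) (simp add: measure_pmf.integrable_const_bound[where B = 1])
  also have "(\<lambda>h. \<Sum>i\<in>I. indicat_real {h. P i h} h) = (\<lambda>h. real (card {i\<in>I. P i h}))"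
    using assms by (auto simp: indicator_def sum.If_cases Int_def)
  finally show ?thesis .
qed

text \<open>Monotonicity of expectation for counts. Since the comparison is needed on reachable
  histories only, the budget can be used in it.\<close>

lemma sum_prob_le:
  fixes M :: "'a pmf" and c :: real
  assumes "finite I" "finite J"
    and le: "\<And>h. h \<in> set_pmf M \<Longrightarrow> real (card {i\<in>I. P i h}) \<le> c * real (card {j\<in>J. Q j h})"
  shows "(\<Sum>i\<in>I. measure_pmf.prob M {h. P i h}) \<le> c * (\<Sum>j\<in>J. measure_pmf.prob M {h. Q j h})"
proof -
  have "integrable (measure_pmf M) (\<lambda>h. real (card {i\<in>I. P i h}))"
    by (rule measure_pmf.integrable_const_bound[where B = "real (card I)"])
       (auto intro!: card_mono assms)
  moreover have "integrable (measure_pmf M) (\<lambda>h. real (card {j\<in>J. Q j h}))"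
    by (rule measure_pmf.integrable_const_bound[where B = "real (card J)"])
       (auto intro!: card_mono assms)
  ultimately have "measure_pmf.expectation M (\<lambda>h. real (card {i\<in>I. P i h}))
      \<le> measure_pmf.expectation M (\<lambda>h. c * real (card {j\<in>J. Q j h}))"
    by (intro integral_mono_AE) (auto simp: AE_measure_pmf_iff le)
  thus ?thesis
    by (simp add: sum_prob_eq_expectation_card assms)
qed

section \<open>Counting embeddings into a small edge set\<close>

definition orientations :: "edge set \<Rightarrow> (nat \<times> nat) set" where
  "orientations S = {(x, y). {x, y} \<in> S}"

lemma card_orientations:
  assumes "finite S" "\<And>e. e \<in> S \<Longrightarrow> card e = 2"
  shows "finite (orientations S)" "card (orientations S) \<le> 2 * card S"
proof -
  have *: "finite {(x, y). {x, y} = e} \<and> card {(x, y). {x, y} = e} \<le> 2" if "e \<in> S" for e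
  proof -
    obtain u v where "e = {u, v}" using assms(2)[OF \<open>e \<in> S\<close>] by (auto simp: card_2_iff)
    hence sub: "{(x, y). {x, y} = e} \<subseteq> {(u, v), (v, u)}" by (auto simp: doubleton_eq_iff)
    moreover have "card {(u, v), (v, u)} \<le> 2" by (simp add: card_insert_le_m1)
    ultimately show ?thesis by (meson card_mono finite.emptyI finite.insertI finite_subset le_trans)
  qed
  have eq: "orientations S = (\<Union>e\<in>S. {(x, y). {x, y} = e})" by (auto simp: orientations_def)
  show "finite (orientations S)" unfolding eq using assms * by blast
  have "card (orientations S) \<le> (\<Sum>e\<in>S. card {(x, y). {x, y} = e})"
    unfolding eq using assms by (intro card_UN_le) auto
  also have "\<dots> \<le> (\<Sum>e\<in>S. 2)" using * by (intro sum_mono) auto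
  finally show "card (orientations S) \<le> 2 * card S" by simp
qed

text \<open>Extensional functions keep the set finite and make a map determined by its values on
  \<open>V\<close>.\<close>

definition embeddings :: "nat set \<Rightarrow> nat \<Rightarrow> (nat \<Rightarrow> nat) set" where
  "embeddings V n = {f \<in> V \<rightarrow>\<^sub>E {1..n}. inj_on f V}"

lemma finite_embeddings [simp]: "finite V \<Longrightarrow> finite (embeddings V n)"
  unfolding embeddings_def by (rule finite_subset[of _ "V \<rightarrow>\<^sub>E {1..n}"]) (auto intro: finite_PiE)

lemma two_set_Min_Max:
  fixes e :: "nat set"
  assumes "card e = 2"
  shows "e = {Min e, Max e}" "Min e \<noteq> Max e"
proof -
  obtain u v where "e = {u, v}" "u \<noteq> v" using assms by (auto simp: card_2_iff)
  thus "e = {Min e, Max e}" "Min e \<noteq> Max e" by (auto simp: min_def max_def)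
qed

text \<open>A map is encoded by the oriented images of the edges in \<open>J\<close>, at most
  \<open>2 * b\<close> choices each, and by its values on the vertices that \<open>J\<close> leaves
  uncovered, at most \<open>n\<close> choices each. \<open>Min\<close> and \<open>Max\<close> serve
  only to order the two ends of an edge.\<close>

lemma card_embeddings_into_le:
  assumes "finite V" "finite J" and J: "\<And>e. e \<in> J \<Longrightarrow> e \<subseteq> V \<and> card e = 2"
    and S: "finite S" "\<And>e. e \<in> S \<Longrightarrow> card e = 2" "card S \<le> b"
  shows "card {f \<in> embeddings V n. (`) f ` J \<subseteq> S} \<le> (2 * b) ^ card J * n ^ card (V - \<Union>J)"
proof -
  let ?F = "{f \<in> embeddings V n. (`) f ` J \<subseteq> S}"
  let ?\<phi> = "\<lambda>f. (\<lambda>e\<in>J. (f (Min e), f (Max e)), restrict f (V - \<Union>J))"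
  let ?T = "(J \<rightarrow>\<^sub>E orientations S) \<times> ((V - \<Union>J) \<rightarrow>\<^sub>E {1..n})"
  have inj: "inj_on ?\<phi> ?F"
  proof (rule inj_onI)
    fix f g assume f: "f \<in> ?F" and g: "g \<in> ?F" and eq: "?\<phi> f = ?\<phi> g"
    have "f v = g v" if v: "v \<in> V" for v
    proof (cases "v \<in> \<Union>J")
      case True
      then obtain e where e: "e \<in> J" "v \<in> e" by blast
      have "(\<lambda>e\<in>J. (f (Min e), f (Max e))) e = (\<lambda>e\<in>J. (g (Min e), g (Max e))) e"
        using eq by (simp only: prod.inject)
      hence "f (Min e) = g (Min e)" "f (Max e) = g (Max e)" using e by auto
      moreover have "v = Min e \<or> v = Max e" using two_set_Min_Max(1)[of e] J[OF e(1)] e(2) by blast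
      ultimately show ?thesis by auto
    next
      case False
      have "restrict f (V - \<Union>J) v = restrict g (V - \<Union>J) v" using eq by (simp only: prod.inject)
      thus ?thesis using False v by simp
    qed
    thus "f = g" using f g
      by (intro PiE_ext[of f V "\<lambda>_. {1..n}" g]) (auto simp: embeddings_def)
  qed
  have im: "?\<phi> ` ?F \<subseteq> ?T"
  proof
    fix z assume "z \<in> ?\<phi> ` ?F"
    then obtain f where f: "f \<in> embeddings V n" "(`) f ` J \<subseteq> S" and z: "z = ?\<phi> f" by blast
    have "(f (Min e), f (Max e)) \<in> orientations S" if "e \<in> J" for e
    proof -
      have "f ` e = {f (Min e), f (Max e)}" using two_set_Min_Max(1)[of e] J[OF that] by (metis image_empty image_insert)
      thus ?thesis using f that by (auto simp: orientations_def)
    qed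
    thus "z \<in> ?T" using f z by (auto simp: embeddings_def)
  qed
  have fo: "finite (orientations S)" "card (orientations S) \<le> 2 * b"
    using card_orientations[OF S(1,2)] S(3) by auto
  have "card ?F \<le> card ?T"
    using fo assms by (intro card_inj_on_le[OF inj im] finite_cartesian_product finite_PiE) auto
  also have "\<dots> = card (orientations S) ^ card J * n ^ card (V - \<Union>J)"
    using assms by (simp add: card_cartesian_product card_PiE)
  also have "\<dots> \<le> (2 * b) ^ card J * n ^ card (V - \<Union>J)"
    using fo by (intro mult_right_mono power_mono) auto
  finally show ?thesis .
qed

text \<open>The oriented image of the pendant edge determines where \<open>d\<close> goes, so the
  new vertex costs a factor \<open>2 * b\<close> instead of \<open>n\<close>.\<close>

lemma card_embeddings_pendant_le:
  assumes "finite V" "x \<in> V" "d \<notin> V" and J: "\<And>e. e \<in> J \<Longrightarrow> e \<subseteq> V"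
    and S: "finite S" "\<And>e. e \<in> S \<Longrightarrow> card e = 2" "card S \<le> b"
  shows "card {f \<in> embeddings (insert d V) n. (`) f ` insert {x, d} J \<subseteq> S}
     \<le> 2 * b * card {f \<in> embeddings V n. (`) f ` J \<subseteq> S}"
proof -
  let ?F = "{f \<in> embeddings (insert d V) n. (`) f ` insert {x, d} J \<subseteq> S}"
  let ?G = "{f \<in> embeddings V n. (`) f ` J \<subseteq> S}"
  let ?\<phi> = "\<lambda>f. ((f x, f d), restrict f V)"
  have inj: "inj_on ?\<phi> ?F"
  proof (rule inj_onI)
    fix f g assume f: "f \<in> ?F" and g: "g \<in> ?F" and eq: "?\<phi> f = ?\<phi> g"
    have "f v = g v" if v: "v \<in> insert d V" for v
    proof (cases "v = d")
      case False
      have "restrict f V v = restrict g V v" using eq by (simp only: prod.inject)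
      thus ?thesis using False v by simp
    qed (use eq in simp)
    thus "f = g" using f g
      by (intro PiE_ext[of f "insert d V" "\<lambda>_. {1..n}" g]) (auto simp: embeddings_def)
  qed
  have im: "?\<phi> ` ?F \<subseteq> orientations S \<times> ?G"
  proof
    fix z assume "z \<in> ?\<phi> ` ?F"
    then obtain f where f: "f \<in> embeddings (insert d V) n" "(`) f ` insert {x, d} J \<subseteq> S" and z: "z = ?\<phi> f" by blast
    have "restrict f V ` e = f ` e" if "e \<in> J" for e using J[OF that] by (auto simp: image_def subset_iff)
    hence "(`) (restrict f V) ` J \<subseteq> S" using f by auto
    moreover have "restrict f V \<in> embeddings V n" using f by (auto simp: embeddings_def inj_on_def)
    ultimately show "z \<in> orientations S \<times> ?G" using f z by (auto simp: orientations_def)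
  qed
  have fo: "finite (orientations S)" "card (orientations S) \<le> 2 * b"
    using card_orientations[OF S(1,2)] S(3) by auto
  have "card ?F \<le> card (orientations S \<times> ?G)"
    using fo assms by (intro card_inj_on_le[OF inj im] finite_cartesian_product) auto
  also have "\<dots> \<le> 2 * b * card ?G" using fo by (auto simp: card_cartesian_product)
  finally show ?thesis .
qed

section \<open>Peeling inequalities for an arbitrary pattern\<close>

locale builder_game =
  fixes n t b :: nat and B :: rule and p :: real
  assumes strategy: "is_strategy n t b B"
    and t_le: "real t \<le> p * card (complete_edges n)"
    and p: "0 \<le> p" "p \<le> 1"
begin

definition expected_copies :: "nat set \<Rightarrow> edge set \<Rightarrow> real" where
  "expected_copies V J = (\<Sum>f\<in>embeddings V n. prob_purchase n t B ((`) f ` J))"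

lemma purchased_support:
  assumes "h \<in> set_pmf (process n t B)"
  shows "card (purchased h) \<le> b" "e \<in> purchased h \<Longrightarrow> card e = 2"
  using strategy assms set_pmf_process[OF assms] by (auto simp: is_strategy_def complete_edges_def)

lemma expected_copies_le_budget:
  assumes "finite V" "finite J" "\<And>e. e \<in> J \<Longrightarrow> e \<subseteq> V \<and> card e = 2"
  shows "expected_copies V J \<le> (2 * real b) ^ card J * real n ^ card (V - \<Union>J)"
proof -
  \<comment> \<open>The one-element index set turns \<open>sum_prob_le\<close> into a comparison
    with a constant.\<close>
  have "expected_copies V J \<le> (2 * real b) ^ card J * real n ^ card (V - \<Union>J) *
      (\<Sum>j\<in>{()}. measure_pmf.prob (process n t B) {h. True})"
    unfolding expected_copies_def prob_purchase_def
  proof (rule sum_prob_le)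
    fix h assume h: "h \<in> set_pmf (process n t B)"
    have "card {f \<in> embeddings V n. (`) f ` J \<subseteq> purchased h} \<le> (2 * b) ^ card J * n ^ card (V - \<Union>J)"
      using assms purchased_support[OF h] by (intro card_embeddings_into_le) auto
    hence "real (card {f \<in> embeddings V n. (`) f ` J \<subseteq> purchased h}) \<le> real ((2 * b) ^ card J * n ^ card (V - \<Union>J))"
      by (simp only: of_nat_le_iff)
    thus "real (card {f \<in> embeddings V n. (`) f ` J \<subseteq> purchased h}) \<le>
      (2 * real b) ^ card J * real n ^ card (V - \<Union>J) * real (card {j \<in> {()}. True})" by simp
  qed (use assms in auto)
  thus ?thesis by simp
qed

lemma expected_copies_pendant_le:
  assumes "finite V" "x \<in> V" "d \<notin> V" "\<And>e. e \<in> J \<Longrightarrow> e \<subseteq> V"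
  shows "expected_copies (insert d V) (insert {x, d} J) \<le> 2 * real b * expected_copies V J"
  unfolding expected_copies_def prob_purchase_def
proof (rule sum_prob_le)
  fix h assume h: "h \<in> set_pmf (process n t B)"
  have "card {f \<in> embeddings (insert d V) n. (`) f ` insert {x, d} J \<subseteq> purchased h}
     \<le> 2 * b * card {f \<in> embeddings V n. (`) f ` J \<subseteq> purchased h}"
    using assms purchased_support[OF h] by (intro card_embeddings_pendant_le) auto
  hence "real (card {f \<in> embeddings (insert d V) n. (`) f ` insert {x, d} J \<subseteq> purchased h})
     \<le> real (2 * b * card {f \<in> embeddings V n. (`) f ` J \<subseteq> purchased h})"
    by (simp only: of_nat_le_iff)
  thus "real (card {f \<in> embeddings (insert d V) n. (`) f ` insert {x, d} J \<subseteq> purchased h})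
     \<le> 2 * real b * real (card {f \<in> embeddings V n. (`) f ` J \<subseteq> purchased h})" by simp
qed (use assms in auto)

text \<open>\<open>prob_purchase_le_sum\<close> summed over all embeddings; injectivity of
  \<open>f\<close> keeps the images of distinct pattern edges distinct, so deleting an edge commutes
  with taking images.\<close>

lemma expected_copies_step:
  assumes "finite V" "finite J" "J \<noteq> {}" "\<And>e. e \<in> J \<Longrightarrow> e \<subseteq> V"
  shows "expected_copies V J \<le> p * (\<Sum>e\<in>J. expected_copies V (J - {e}))"
proof -
  have "prob_purchase n t B ((`) f ` J) \<le> p * (\<Sum>e\<in>J. prob_purchase n t B ((`) f ` (J - {e})))"
    if "f \<in> embeddings V n" for f
  proof -
    have inj: "inj_on ((`) f) J"
      using that assms inj_on_image_eq_iff[of f V] by (auto simp: embeddings_def inj_on_def[of _ J])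
    have "prob_purchase n t B ((`) f ` J) \<le> p * (\<Sum>e\<in>(`) f ` J. prob_purchase n t B ((`) f ` J - {e}))"
      using assms t_le p by (intro prob_purchase_le_sum) auto
    also have "(\<Sum>e\<in>(`) f ` J. prob_purchase n t B ((`) f ` J - {e}))
       = (\<Sum>e\<in>J. prob_purchase n t B ((`) f ` J - {f ` e}))"
      using inj by (subst sum.reindex) auto
    also have "\<dots> = (\<Sum>e\<in>J. prob_purchase n t B ((`) f ` (J - {e})))"
      using inj by (intro sum.cong refl arg_cong[where f = "prob_purchase n t B"]) (auto simp: inj_on_def)
    finally show ?thesis .
  qed
  hence "expected_copies V J \<le> (\<Sum>f\<in>embeddings V n. p * (\<Sum>e\<in>J. prob_purchase n t B ((`) f ` (J - {e}))))"
    unfolding expected_copies_def by (intro sum_mono)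
  also have "\<dots> = p * (\<Sum>e\<in>J. expected_copies V (J - {e}))"
    unfolding expected_copies_def by (subst sum.swap) (simp add: sum_distrib_left)
  finally show ?thesis .
qed

text \<open>Each of the \<open>j\<close> peelings costs a factor \<open>p\<close> and at most
  \<open>r\<close> choices of the last edge, until \<open>i\<close> edges are left.\<close>

lemma expected_copies_iterate:
  assumes "finite V" "finite R" "card R \<le> r" "\<And>e. e \<in> R \<Longrightarrow> e \<subseteq> V" "0 \<le> X"
    and X: "\<And>J. J \<subseteq> R \<Longrightarrow> card J = i \<Longrightarrow> expected_copies V J \<le> X"
    and "J \<subseteq> R" "card J = i + j"
  shows "expected_copies V J \<le> (real r * p) ^ j * X"
  using assms(7,8)
proof (induction j arbitrary: J)
  case 0
  thus ?case using X by simp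
next
  case (Suc j)
  have finJ: "finite J" using Suc.prems assms finite_subset by blast
  have cJ: "card J \<le> r" using Suc.prems assms card_mono[of R J] by simp
  have "expected_copies V J \<le> p * (\<Sum>e\<in>J. expected_copies V (J - {e}))"
    using Suc.prems assms finJ by (intro expected_copies_step) auto
  also have "\<dots> \<le> p * (\<Sum>e\<in>J. (real r * p) ^ j * X)"
    using Suc.prems finJ p by (intro mult_left_mono sum_mono Suc.IH) auto
  also have "\<dots> = p * real (card J) * ((real r * p) ^ j * X)" by simp
  also have "\<dots> \<le> p * real r * ((real r * p) ^ j * X)"
    using cJ p assms by (intro mult_mono mult_nonneg_nonneg) auto
  finally show ?case by (simp add: mult_ac)
qed

text \<open>Peeling the pendant edge would leave \<open>d\<close> uncovered and cost a factor
  \<open>n\<close>, so that edge is charged to the budget. Then one triangle edge is peeled, and the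
  remaining path covers all three vertices: \<open>2b * 3p * (2b)^2\<close>.\<close>

lemma expected_copies_paw:
  assumes "distinct [u, v, c, d]" "x \<in> {u, v}"
  shows "expected_copies {u, v, c, d} {{u, v}, {u, c}, {v, c}, {x, d}} \<le> 24 * real b ^ 3 * p"
proof -
  let ?V = "{u, v, c}" and ?T = "{{u, v}, {u, c}, {v, c}}"
  have T: "\<And>e. e \<in> ?T \<Longrightarrow> e \<subseteq> ?V \<and> card e = 2" using assms by auto
  have two: "expected_copies ?V (?T - {e}) \<le> (2 * real b)\<^sup>2" if "e \<in> ?T" for e
  proof -
    have ne: "{u, v} \<noteq> {u, c}" "{u, v} \<noteq> {v, c}" "{u, c} \<noteq> {v, c}"
      using assms by (auto simp: doubleton_eq_iff)
    have "card ?T = 3" using ne by simp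
    hence "card (?T - {e}) = 2" using that by (simp add: card_Diff_singleton)
    moreover have "?V - \<Union>(?T - {e}) = {}" using that ne assms by (auto simp: doubleton_eq_iff)
    ultimately show ?thesis using expected_copies_le_budget[of ?V "?T - {e}"] T by auto
  qed
  have "{u, v, c, d} = insert d ?V" "{{u, v}, {u, c}, {v, c}, {x, d}} = insert {x, d} ?T" by auto
  hence *: "expected_copies {u, v, c, d} {{u, v}, {u, c}, {v, c}, {x, d}} \<le> 2 * real b * expected_copies ?V ?T"
    using assms expected_copies_pendant_le[of ?V x d ?T] by auto
  have "(\<Sum>e\<in>?T. expected_copies ?V (?T - {e})) \<le> (\<Sum>e\<in>?T. (2 * real b)\<^sup>2)" by (intro sum_mono two)
  also have "\<dots> = real (card ?T) * (2 * real b)\<^sup>2" by simp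
  also have "\<dots> \<le> 3 * (2 * real b)\<^sup>2" by (intro mult_right_mono) (auto simp: card_insert_if)
  finally have "p * (\<Sum>e\<in>?T. expected_copies ?V (?T - {e})) \<le> p * (3 * (2 * real b)\<^sup>2)"
    using p by (intro mult_left_mono)
  hence "expected_copies ?V ?T \<le> p * (3 * (2 * real b)\<^sup>2)"
    using expected_copies_step[of ?V ?T] by fastforce
  hence "2 * real b * expected_copies ?V ?T \<le> 2 * real b * (p * (3 * (2 * real b)\<^sup>2))"
    by (intro mult_left_mono) auto
  thus ?thesis using * by (simp add: power2_eq_square power3_eq_cube algebra_simps)
qed

end

lemma choose_two_bounds:
  shows "n \<ge> 2 \<Longrightarrow> real n ^ 2 / 4 \<le> real (n choose 2)" "real (n choose 2) \<le> real n ^ 2 / 2"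
proof -
  have "even (n * (n - 1))" by (cases n) auto
  hence "2 * (n choose 2) = n * (n - 1)" unfolding choose_two by (rule dvd_mult_div_cancel)
  hence "2 * real (n choose 2) = real n * real (n - 1)"
    by (metis of_nat_mult of_nat_numeral)
  hence *: "real (n choose 2) = real n * real (n - 1) / 2" by simp
  show "real (n choose 2) \<le> real n ^ 2 / 2"
    unfolding * power2_eq_square by (intro divide_right_mono mult_left_mono) auto
  show "real n ^ 2 / 4 \<le> real (n choose 2)" if "n \<ge> 2"
  proof -
    have "real n / 2 \<le> real (n - 1)" using that by (simp add: of_nat_diff)
    hence "real n * (real n / 2) \<le> real n * real (n - 1)" by (intro mult_left_mono) auto
    thus ?thesis unfolding * power2_eq_square by simp
  qed
qed

section \<open>Three upper bounds for the success probability\<close>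

context builder_game
begin

lemma prob_K4_minus_le_expected:
  "prob_K4_minus n t B \<le> expected_copies {1, 2, 3, 4} (snd K4_minus)"
proof -
  let ?V = "{1, 2, 3, 4} :: nat set" and ?R = "snd K4_minus"
  have "{h. contains_copy (builder_graph n h) K4_minus} \<subseteq> (\<Union>f\<in>embeddings ?V n. {h. (`) f ` ?R \<subseteq> purchased h})"
  proof
    fix h assume "h \<in> {h. contains_copy (builder_graph n h) K4_minus}"
    moreover have "fst K4_minus = ?V" by (simp add: K4_minus_def)
    ultimately obtain f where f: "inj_on f ?V" "f ` ?V \<subseteq> {1..n}" "\<And>e. e \<in> ?R \<Longrightarrow> f ` e \<in> purchased h"
      unfolding contains_copy_def builder_graph_def by auto
    have "restrict f ?V \<in> embeddings ?V n" using f(1,2) by (auto simp: embeddings_def inj_on_def)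
    moreover have "restrict f ?V ` e = f ` e" if "e \<in> ?R" for e
      using that by (auto simp: K4_minus_def)
    hence "(`) (restrict f ?V) ` ?R \<subseteq> purchased h" using f(3) by auto
    ultimately show "h \<in> (\<Union>f\<in>embeddings ?V n. {h. (`) f ` ?R \<subseteq> purchased h})" by blast
  qed
  hence "prob_K4_minus n t B \<le> measure_pmf.prob (process n t B) (\<Union>f\<in>embeddings ?V n. {h. (`) f ` ?R \<subseteq> purchased h})"
    unfolding prob_K4_minus_def by (intro measure_pmf.finite_measure_mono) auto
  also have "\<dots> \<le> expected_copies ?V ?R"
    unfolding expected_copies_def prob_purchase_def
    by (intro measure_pmf.finite_measure_subadditive_finite) auto
  finally show ?thesis .
qed

lemma K4_minus_edges:
  "finite (snd K4_minus)" "card (snd K4_minus) = 5"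
  "e \<in> snd K4_minus \<Longrightarrow> e \<subseteq> {1, 2, 3, 4} \<and> card e = 2"
  subgoal by (simp add: K4_minus_def)
  subgoal by (simp add: K4_minus_def doubleton_eq_iff)
  subgoal by (auto simp: K4_minus_def)
  done

text \<open>All five edges are peeled, which gives \<open>(5 * p) ^ 5\<close> times the number of
  vertex maps.\<close>

lemma prob_K4_minus_le_unrestricted: "prob_K4_minus n t B \<le> 3125 * p ^ 5 * real n ^ 4"
proof -
  have "expected_copies {1, 2, 3, 4} (snd K4_minus) \<le> (real 5 * p) ^ 5 * real n ^ 4"
  proof (rule expected_copies_iterate[where i = 0 and R = "snd K4_minus"])
    fix J assume J: "J \<subseteq> snd K4_minus" "card J = 0"
    hence "J = {}" using K4_minus_edges(1) by (metis card_0_eq finite_subset)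
    thus "expected_copies {1, 2, 3, 4} J \<le> real n ^ 4"
      using expected_copies_le_budget[of "{1, 2, 3, 4}" "{}"] by (simp add: power4_eq_xxxx)
  qed (use K4_minus_edges in auto)
  thus ?thesis using prob_K4_minus_le_expected by (simp add: power_mult_distrib)
qed

text \<open>Four peelings leave a single purchased edge, with at most \<open>2 * b\<close> oriented
  images and two free vertices.\<close>

lemma prob_K4_minus_le_sparse: "prob_K4_minus n t B \<le> 1250 * real b * p ^ 4 * real n ^ 2"
proof -
  have "expected_copies {1, 2, 3, 4} (snd K4_minus) \<le> (real 5 * p) ^ 4 * (2 * real b * real n ^ 2)"
  proof (rule expected_copies_iterate[where i = 1 and R = "snd K4_minus"])
    fix J assume J: "J \<subseteq> snd K4_minus" "card J = 1"
    then obtain e where e: "J = {e}" "e \<in> snd K4_minus" by (auto simp: card_1_singleton_iff)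
    have "card ({1, 2, 3, 4} - e) = 2" using K4_minus_edges(3)[OF e(2)] by (simp add: card_Diff_subset finite_subset[of e "{1, 2, 3, 4}"])
    thus "expected_copies {1, 2, 3, 4} J \<le> 2 * real b * real n ^ 2"
      using expected_copies_le_budget[of "{1, 2, 3, 4}" "{e}"] K4_minus_edges(3)[OF e(2)] e(1)
      by (simp del: card_Diff_insert)
  qed (use K4_minus_edges in auto)
  thus ?thesis using prob_K4_minus_le_expected by (simp add: power_mult_distrib mult_ac)
qed

text \<open>Removing any edge of the 4-cycle leaves a path through all four vertices, so the budget
  alone bounds the remaining count by \<open>(2 * b) ^ 3\<close>.\<close>

lemma expected_copies_C4:
  "expected_copies {1, 2, 3, 4} {{1, 3}, {1, 4}, {2, 3}, {2, 4}} \<le> 32 * real b ^ 3 * p"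
proof -
  let ?V = "{1, 2, 3, 4} :: nat set" and ?C = "{{1, 3}, {1, 4}, {2, 3}, {2, 4}} :: nat set set"
  have C: "card ?C = 4" by (simp add: doubleton_eq_iff)
  have "expected_copies ?V (?C - {e}) \<le> (2 * real b) ^ 3" if e: "e \<in> ?C" for e
  proof -
    have "?V - \<Union>(?C - {e}) = {}"
      using e by (elim insertE emptyE) (auto simp: insert_Diff_if doubleton_eq_iff)
    moreover have "card (?C - {e}) = 3" using e C by (simp add: card_Diff_singleton)
    moreover have "e' \<subseteq> ?V \<and> card e' = 2" if "e' \<in> ?C - {e}" for e' using that by auto
    hence "expected_copies ?V (?C - {e}) \<le> (2 * real b) ^ card (?C - {e}) * real n ^ card (?V - \<Union>(?C - {e}))"
      by (intro expected_copies_le_budget) blast+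
    ultimately show ?thesis by (simp only: card.empty power_0 mult_1_right)
  qed
  hence "(\<Sum>e\<in>?C. expected_copies ?V (?C - {e})) \<le> (\<Sum>e\<in>?C. (2 * real b) ^ 3)" by (intro sum_mono)
  also have "\<dots> = 4 * (2 * real b) ^ 3" using C by simp
  finally have "p * (\<Sum>e\<in>?C. expected_copies ?V (?C - {e})) \<le> p * (4 * (2 * real b) ^ 3)"
    using p by (intro mult_left_mono)
  moreover have "expected_copies ?V ?C \<le> p * (\<Sum>e\<in>?C. expected_copies ?V (?C - {e}))"
    by (intro expected_copies_step) auto
  ultimately have "expected_copies ?V ?C \<le> p * (4 * (2 * real b) ^ 3)" by (rule order_trans[rotated])
  thus ?thesis by (simp add: power_mult_distrib mult_ac)
qed

text \<open>Removing the edge between the two vertices of degree three leaves a 4-cycle, removing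
  any other edge a triangle with a pendant edge. Either costs at most \<open>32 b^3 p\<close>, and
  there are five edges to peel.\<close>

lemma prob_K4_minus_le_dense: "prob_K4_minus n t B \<le> 160 * real b ^ 3 * p ^ 2"
proof -
  let ?V = "{1, 2, 3, 4} :: nat set"
  have paw: "expected_copies ?V J \<le> 32 * real b ^ 3 * p"
    if "distinct [u, v, c, d]" "x \<in> {u, v}" "{u, v, c, d} = ?V" "{{u, v}, {u, c}, {v, c}, {x, d}} = J"
    for u v c d x J
  proof -
    have "expected_copies ?V J \<le> 24 * real b ^ 3 * p" using expected_copies_paw[OF that(1,2)] that(3,4) by simp
    also have "\<dots> \<le> 32 * real b ^ 3 * p" using p by (intro mult_right_mono) auto
    finally show ?thesis .
  qed
  have four: "expected_copies ?V (snd K4_minus - {e}) \<le> 32 * real b ^ 3 * p" if "e \<in> snd K4_minus" for e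
  proof -
    consider "e = {1, 2}" | "e = {1, 3}" | "e = {1, 4}" | "e = {2, 3}" | "e = {2, 4}"
      using \<open>e \<in> snd K4_minus\<close> by (auto simp: K4_minus_def)
    thus ?thesis
    proof cases
      case 1
      hence "snd K4_minus - {e} = {{1, 3}, {1, 4}, {2, 3}, {2, 4}}"
        by (auto simp: K4_minus_def insert_Diff_if doubleton_eq_iff)
      thus ?thesis using expected_copies_C4 by simp
    next
      case 2
      show ?thesis by (rule paw[of 1 2 4 3 2]) (auto simp: 2 K4_minus_def insert_Diff_if doubleton_eq_iff)
    next
      case 3
      show ?thesis by (rule paw[of 1 2 3 4 2]) (auto simp: 3 K4_minus_def insert_Diff_if doubleton_eq_iff)
    next
      case 4
      show ?thesis by (rule paw[of 1 2 4 3 1]) (auto simp: 4 K4_minus_def insert_Diff_if doubleton_eq_iff)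
    next
      case 5
      show ?thesis by (rule paw[of 1 2 3 4 1]) (auto simp: 5 K4_minus_def insert_Diff_if doubleton_eq_iff)
    qed
  qed
  have "(\<Sum>e\<in>snd K4_minus. expected_copies ?V (snd K4_minus - {e})) \<le> (\<Sum>e\<in>snd K4_minus. 32 * real b ^ 3 * p)"
    by (intro sum_mono four)
  also have "\<dots> = 5 * (32 * real b ^ 3 * p)" using K4_minus_edges(2) by simp
  finally have "p * (\<Sum>e\<in>snd K4_minus. expected_copies ?V (snd K4_minus - {e})) \<le> p * (5 * (32 * real b ^ 3 * p))"
    using p by (intro mult_left_mono)
  moreover have "expected_copies ?V (snd K4_minus) \<le> p * (\<Sum>e\<in>snd K4_minus. expected_copies ?V (snd K4_minus - {e}))"
    using K4_minus_edges by (intro expected_copies_step) auto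
  ultimately show ?thesis using prob_K4_minus_le_expected by (simp add: power2_eq_square mult_ac)
qed

end

section \<open>From the density to the thresholds\<close>

lemma builder_game_edge_density:
  assumes "is_strategy n t b B" "t \<le> n choose 2" "n \<ge> 2"
  shows "builder_game n t b B (real t / real (n choose 2))"
    "real t / real (n choose 2) \<le> 4 * (real t / real n ^ 2)"
proof -
  have pos: "n choose 2 > 0" using assms by simp
  show "builder_game n t b B (real t / real (n choose 2))"
    using assms pos by unfold_locales (auto simp: card_complete_edges)
  have "real t / real (n choose 2) \<le> real t / (real n ^ 2 / 4)"
    using assms choose_two_bounds(1)[of n] by (intro divide_left_mono) auto
  thus "real t / real (n choose 2) \<le> 4 * (real t / real n ^ 2)" by (simp add: mult.commute)
qed

lemma prob_K4_minus_le_time: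
  assumes "is_strategy n t b B" "t \<le> n choose 2" "n \<ge> 2"
  shows "prob_K4_minus n t B \<le> 3200000 * (real t / real n powr (6/5)) ^ 5"
proof -
  let ?p = "real t / real (n choose 2)"
  interpret builder_game n t b B ?p using builder_game_edge_density(1)[OF assms] .
  have "prob_K4_minus n t B \<le> 3125 * ?p ^ 5 * real n ^ 4" by (rule prob_K4_minus_le_unrestricted)
  also have "\<dots> \<le> 3125 * (4 * (real t / real n ^ 2)) ^ 5 * real n ^ 4"
    using builder_game_edge_density(2)[OF assms] by (intro mult_right_mono mult_left_mono power_mono) auto
  also have "\<dots> = 3200000 * (real t ^ 5 / real n ^ 6)"
    using assms by (simp add: power_mult_distrib power_divide field_simps flip: power_mult power_add)
  also have "real n ^ 6 = (real n powr (6/5)) ^ 5"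
    using assms by (simp add: powr_power)
  finally show ?thesis by (simp add: power_divide)
qed

text \<open>Whichever term attains the maximum in \<open>b_star\<close> selects the bound: the
  sparse one is linear in \<open>b\<close>, the dense one cubic. Adding the two avoids a case
  distinction in the conclusion.\<close>

lemma prob_K4_minus_le_budget:
  assumes "is_strategy n t b B" "t \<le> n choose 2" "n \<ge> 2"
  shows "prob_K4_minus n t B \<le> 320000 * (real b / b_star n t) + 2560 * (real b / b_star n t) ^ 3"
proof -
  have nn: "0 \<le> 320000 * (real b / b_star n t)" "0 \<le> 2560 * (real b / b_star n t) ^ 3"
    by (auto simp: b_star_def intro!: divide_nonneg_nonneg mult_nonneg_nonneg zero_le_power max.coboundedI1)
  show ?thesis
  proof (cases "t = 0")
    \<comment> \<open>At \<open>t = 0\<close> division by zero makes \<open>b_star\<close> and hence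
      the right side zero; the time bound shows that the probability is zero too.\<close>
    case True
    hence "prob_K4_minus n t B \<le> 0" using prob_K4_minus_le_time[OF assms] by simp
    thus ?thesis using nn by linarith
  next
    case False
    let ?p = "real t / real (n choose 2)"
    interpret builder_game n t b B ?p using builder_game_edge_density(1)[OF assms] .
    note p4 = builder_game_edge_density(2)[OF assms]
    show ?thesis
    proof (cases "real n powr (4/3) / real t powr (2/3) \<le> real n ^ 6 / real t ^ 4")
      case True
      hence bs: "b_star n t = real n ^ 6 / real t ^ 4" by (simp add: b_star_def)
      have "prob_K4_minus n t B \<le> 1250 * real b * ?p ^ 4 * real n ^ 2" by (rule prob_K4_minus_le_sparse)
      also have "\<dots> \<le> 1250 * real b * (4 * (real t / real n ^ 2)) ^ 4 * real n ^ 2"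
        using p4 by (intro mult_right_mono mult_left_mono power_mono) auto
      also have "\<dots> = 320000 * (real b / b_star n t)"
        using assms by (simp add: bs power_mult_distrib power_divide field_simps flip: power_mult power_add)
      finally show ?thesis using nn by linarith
    next
      case False
      hence bs: "b_star n t = real n powr (4/3) / real t powr (2/3)" by (simp add: b_star_def)
      have cube: "(real n powr (4/3)) ^ 3 = real n ^ 4" "(real t powr (2/3)) ^ 3 = real t ^ 2"
        using assms \<open>t \<noteq> 0\<close> by (simp_all add: powr_power)
      have "prob_K4_minus n t B \<le> 160 * real b ^ 3 * ?p ^ 2" by (rule prob_K4_minus_le_dense)
      also have "\<dots> \<le> 160 * real b ^ 3 * (4 * (real t / real n ^ 2)) ^ 2"
        using p4 by (intro mult_right_mono mult_left_mono power_mono) auto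
      also have "\<dots> = 2560 * (real b / b_star n t) ^ 3"
        using assms by (simp add: bs power_mult_distrib power_divide cube field_simps flip: power_mult power_add)
      finally show ?thesis using nn by linarith
    qed
  qed
qed

lemma prob_K4_minus_tendsto_0:
  assumes "eventually (\<lambda>n. t n \<le> n choose 2) sequentially" "\<And>n. is_strategy n (t n) (b n) (B n)"
    and "little_o (\<lambda>n. real (t n)) (\<lambda>n. real n powr (6/5)) \<or> little_o (\<lambda>n. real (b n)) (\<lambda>n. b_star n (t n))"
  shows "(\<lambda>n. prob_K4_minus n (t n) (B n)) \<longlonglongrightarrow> 0"
  using assms(3)
proof
  assume "little_o (\<lambda>n. real (t n)) (\<lambda>n. real n powr (6/5))"
  hence lim: "(\<lambda>n. 3200000 * (real (t n) / real n powr (6/5)) ^ 5) \<longlonglongrightarrow> 0"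
    unfolding little_o_def by (intro tendsto_mult_right_zero tendsto_null_power) auto
  show ?thesis
  proof (rule tendsto_sandwich[OF _ _ tendsto_const lim])
    show "\<forall>\<^sub>F n in sequentially. prob_K4_minus n (t n) (B n) \<le> 3200000 * (real (t n) / real n powr (6/5)) ^ 5"
      using assms(1) eventually_ge_at_top[of 2]
      by eventually_elim (rule prob_K4_minus_le_time[OF assms(2)])
  qed (simp add: prob_K4_minus_def)
next
  assume "little_o (\<lambda>n. real (b n)) (\<lambda>n. b_star n (t n))"
  hence lim: "(\<lambda>n. 320000 * (real (b n) / b_star n (t n)) + 2560 * (real (b n) / b_star n (t n)) ^ 3) \<longlonglongrightarrow> 0"
    unfolding little_o_def by (intro tendsto_add_zero tendsto_mult_right_zero tendsto_null_power) auto
  show ?thesis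
  proof (rule tendsto_sandwich[OF _ _ tendsto_const lim])
    show "\<forall>\<^sub>F n in sequentially. prob_K4_minus n (t n) (B n) \<le>
       320000 * (real (b n) / b_star n (t n)) + 2560 * (real (b n) / b_star n (t n)) ^ 3"
      using assms(1) eventually_ge_at_top[of 2]
      by eventually_elim (rule prob_K4_minus_le_budget[OF assms(2)])
  qed (simp add: prob_K4_minus_def)
qed

section \<open>Strategies with a fixed shopping rule\<close>

fun run :: "(history \<Rightarrow> edge \<Rightarrow> bool) \<Rightarrow> history \<Rightarrow> edge list \<Rightarrow> history" where
  "run D h [] = h"
| "run D h (e # es) = run D (h @ [(e, D h e)]) es"

lemma play_deterministic: "play (\<lambda>h e. return_pmf (D h e)) h es = return_pmf (run D h es)"
  by (induction es arbitrary: h) (simp_all add: bind_return_pmf)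

text \<open>\<open>is_strategy\<close> demands the budget on every history, while the estimates
  control spending only with high probability; the cap enforces the former.\<close>

definition capped :: "nat \<Rightarrow> (history \<Rightarrow> edge \<Rightarrow> bool) \<Rightarrow> history \<Rightarrow> edge \<Rightarrow> bool" where
  "capped b D h e \<longleftrightarrow> D h e \<and> card (purchased h) < b"

lemma purchased_singleton [simp]: "purchased [(e, d)] = (if d then {e} else {})"
  by (auto simp: purchased_def)

lemma card_purchased_run_capped:
  "card (purchased h) \<le> b \<Longrightarrow> card (purchased (run (capped b D) h es)) \<le> b"
proof (induction es arbitrary: h)
  case (Cons e es)
  have "card (purchased (h @ [(e, capped b D h e)])) \<le> b"
    using Cons.prems by (auto simp: capped_def card_insert_if)
  from Cons.IH[OF this] show ?case by simp
qed simp

lemma purchased_run_mono: "purchased h \<subseteq> purchased (run D h es)"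
proof (induction es arbitrary: h)
  case (Cons e es)
  show ?case using Cons.IH[of "h @ [(e, D h e)]"] by auto
qed simp

text \<open>Purchases only accumulate, so a run that ends within budget never meets the cap. Fresh
  edges are needed for a purchase to raise the count.\<close>

lemma run_capped_eq:
  assumes "card (purchased (run D h es)) \<le> b" "distinct es" "set es \<inter> revealed h = {}"
  shows "run (capped b D) h es = run D h es"
  using assms
proof (induction es arbitrary: h)
  case (Cons e es)
  have eq: "capped b D h e = D h e"
  proof (cases "D h e")
    case True
    have "e \<notin> purchased h" using Cons.prems purchased_subset_revealed[of h] by auto
    hence "card (purchased h) < card (insert e (purchased h))" by simp
    also have "\<dots> \<le> card (purchased (run D h (e # es)))"
      using True purchased_run_mono[of "h @ [(e, D h e)]" D es] by (intro card_mono) simp_all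
    also have "\<dots> \<le> b" by (rule Cons.prems(1))
    finally show ?thesis by (simp add: capped_def)
  qed (simp add: capped_def)
  show ?case using Cons.IH[of "h @ [(e, D h e)]"] Cons.prems eq by auto
qed simp

text \<open>\<open>W\<close> sees the revealed edges but not the earlier decisions, so the shopping
  list is a function of the order.\<close>

definition selected :: "(edge list \<Rightarrow> edge \<Rightarrow> bool) \<Rightarrow> edge list \<Rightarrow> edge set" where
  "selected W es = {e. \<exists>xs ys. es = xs @ e # ys \<and> W xs e}"

lemma purchased_run_oblivious:
  "purchased (run (\<lambda>h. W (map fst h)) h es) = purchased h \<union> selected (\<lambda>xs. W (map fst h @ xs)) es"
proof (induction es arbitrary: h)
  case Nil
  show ?case by (simp add: selected_def)
next
  case (Cons e es)
  let ?h = "h @ [(e, W (map fst h) e)]"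
  have "selected (\<lambda>xs. W (map fst h @ xs)) (e # es)
     = (if W (map fst h) e then {e} else {}) \<union> selected (\<lambda>xs. W (map fst ?h @ xs)) es"
    unfolding selected_def by (auto simp: Cons_eq_append_conv)
  thus ?case using Cons.IH[of ?h] by auto
qed

text \<open>Reduces the positive direction to counting orders: whenever the uncapped selection stays
  within budget, the capped rule buys exactly the same edges.\<close>

lemma exists_strategy_selecting:
  "\<exists>B. is_strategy n t b B \<and>
     real (card {es \<in> permutations_of_set (complete_edges n). card (selected W (take t es)) \<le> b \<and>
        contains_copy ({1..n}, selected W (take t es)) K4_minus}) / fact (n choose 2) \<le> prob_K4_minus n t B"
proof -
  let ?D = "\<lambda>h. W (map fst h)"
  let ?B = "\<lambda>h e. return_pmf (capped b ?D h e)"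
  let ?\<Omega> = "permutations_of_set (complete_edges n)"
  let ?good = "{es \<in> ?\<Omega>. card (selected W (take t es)) \<le> b \<and> contains_copy ({1..n}, selected W (take t es)) K4_minus}"
  have proc: "process n t ?B = map_pmf (\<lambda>es. run (capped b ?D) [] (take t es)) (pmf_of_set ?\<Omega>)"
    by (simp add: process_def play_deterministic map_pmf_def)
  have "is_strategy n t b ?B"
    unfolding is_strategy_def proc by (auto intro!: card_purchased_run_capped)
  moreover have "real (card ?good) / fact (n choose 2) \<le> prob_K4_minus n t ?B"
  proof -
    have sub: "?good \<subseteq> ?\<Omega> \<inter> {es. contains_copy (builder_graph n (run (capped b ?D) [] (take t es))) K4_minus}"
    proof
      fix es assume es: "es \<in> ?good"
      have sel: "purchased (run ?D [] (take t es)) = selected W (take t es)"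
        using purchased_run_oblivious[of W "[]"] by simp
      have "run (capped b ?D) [] (take t es) = run ?D [] (take t es)"
        using es sel by (intro run_capped_eq) (auto dest: permutations_of_setD)
      thus "es \<in> ?\<Omega> \<inter> {es. contains_copy (builder_graph n (run (capped b ?D) [] (take t es))) K4_minus}"
        using es sel by (simp add: builder_graph_def)
    qed
    have "real (card ?good) / fact (n choose 2)
       \<le> real (card (?\<Omega> \<inter> {es. contains_copy (builder_graph n (run (capped b ?D) [] (take t es))) K4_minus})) / fact (n choose 2)"
      using sub by (intro divide_right_mono of_nat_mono card_mono) auto
    also have "\<dots> = prob_K4_minus n t ?B"
      unfolding prob_K4_minus_def proc
      by (simp add: measure_pmf_of_set vimage_def card_complete_edges)
    finally show ?thesis .
  qed
  ultimately show ?thesis by blast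
qed

section \<open>The two-phase strategy\<close>

text \<open>The number 10 is twice the five edges of a copy: the second moment has to place pairs of
  copies.\<close>

lemma card_placements_le_power:
  assumes "finite E" "A \<subseteq> E" "B \<subseteq> E" "A \<inter> B = {}" "2 * m \<le> card E"
    and "card A + card B \<le> 10" "card E \<ge> 11"
  shows "real (card (placements E m m A B)) / fact (card E) \<le> (real m / (real (card E) - 10)) ^ (card A + card B)"
proof -
  let ?a = "card A" and ?b = "card B" and ?N = "card E"
  have pos: "real ?N - 10 > 0" using assms by simp
  have "(fact (?N - (?a + ?b)) :: real) * (real ?N - real 10) ^ (?a + ?b) \<le> fact ?N"
    using assms by (intro fact_diff_le) auto
  hence f: "fact (?N - ?a - ?b) / fact ?N \<le> 1 / (real ?N - 10) ^ (?a + ?b)"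
    using pos by (simp add: field_simps)
  have le: "real (fact ?a * (m choose ?a) * (fact ?b * (m choose ?b))) \<le> real m ^ (?a + ?b)"
  proof -
    have "fact ?a * (m choose ?a) * (fact ?b * (m choose ?b)) \<le> m ^ ?a * m ^ ?b"
      by (intro mult_mono fact_times_binomial_le) auto
    thus ?thesis by (metis of_nat_le_iff of_nat_power power_add)
  qed
  have "real (card (placements E m m A B)) / fact ?N
      = real (fact ?a * (m choose ?a) * (fact ?b * (m choose ?b))) * (fact (?N - ?a - ?b) / fact ?N)"
    using assms by (subst card_placements) auto
  also have "\<dots> \<le> real m ^ (?a + ?b) * (1 / (real ?N - 10) ^ (?a + ?b))"
    using f le by (intro mult_mono) auto
  finally show ?thesis by (simp add: power_divide)
qed

lemma fact_times_binomial_ge: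
  assumes "a \<le> m"
  shows "(real m - real a) ^ a \<le> real (fact a * (m choose a))"
proof -
  have "real (fact a * (m choose a)) * fact (m - a) = fact m"
    using arg_cong[OF binomial_fact_lemma[OF assms], of real] by (simp add: mult_ac)
  moreover have "(fact (m - a) :: real) * (real m - real a) ^ a \<le> fact m"
    using assms by (intro fact_diff_le) auto
  ultimately have "(real m - real a) ^ a * fact (m - a) \<le> real (fact a * (m choose a)) * fact (m - a)"
    by (simp add: mult_ac)
  thus ?thesis by simp
qed

text \<open>The matching lower bound for a single copy, three edges in the first phase and two in
  the second. Its base has to agree with the upper one up to a factor tending to 1, or the second
  moment would not give probability near 1.\<close>

lemma card_placements_ge_power:
  assumes "finite E" "A \<subseteq> E" "B \<subseteq> E" "A \<inter> B = {}" "2 * m \<le> card E"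
    and "card A = 3" "card B = 2" "m \<ge> 3"
  shows "((real m - 3) / real (card E)) ^ 5 \<le> real (card (placements E m m A B)) / fact (card E)"
proof -
  let ?N = "card E"
  have N: "?N \<ge> 6" using assms by simp
  have "fact 5 * (?N choose 5) \<le> ?N ^ 5" by (rule fact_times_binomial_le)
  moreover have "(fact ?N :: nat) = fact 5 * (?N choose 5) * fact (?N - 5)"
    using binomial_fact_lemma[of 5 ?N] N by (simp add: mult_ac)
  ultimately have "(fact ?N :: nat) \<le> ?N ^ 5 * fact (?N - 5)" by simp
  hence "real (fact ?N) \<le> real (?N ^ 5 * fact (?N - 5))" by (simp only: of_nat_le_iff)
  hence f: "1 / real ?N ^ 5 \<le> fact (?N - 5) / fact ?N"
    using N by (simp add: field_simps)
  have "(real m - 3) ^ 5 = (real m - 3) ^ 3 * (real m - 3) ^ 2" by (simp flip: power_add)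
  also have "\<dots> \<le> (real m - 3) ^ 3 * (real m - 2) ^ 2"
    using assms by (intro mult_mono power_mono) auto
  also have "\<dots> = (real m - real 3) ^ 3 * (real m - real 2) ^ 2" by simp
  also have "\<dots> \<le> real (fact 3 * (m choose 3)) * real (fact 2 * (m choose 2))"
    using assms by (intro mult_mono fact_times_binomial_ge) auto
  finally have g: "(real m - 3) ^ 5 \<le> real (fact 3 * (m choose 3) * (fact 2 * (m choose 2)))" by simp
  have "((real m - 3) / real ?N) ^ 5 = (real m - 3) ^ 5 * (1 / real ?N ^ 5)" by (simp add: power_divide)
  also have "\<dots> \<le> real (fact 3 * (m choose 3) * (fact 2 * (m choose 2))) * (fact (?N - 5) / fact ?N)"
    using f g assms by (intro mult_mono) auto
  also have "\<dots> = real (card (placements E m m A B)) / fact ?N"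
    using assms card_placements[of E A B m m] by simp
  finally show ?thesis .
qed

text \<open>Membership in a window, rewritten as a condition on the position, which is the form used
  by \<open>selected\<close>.\<close>

lemma set_take_conv_split: "e \<in> set (take m l) \<longleftrightarrow> (\<exists>xs ys. l = xs @ e # ys \<and> length xs < m)"
proof
  assume "e \<in> set (take m l)"
  then obtain xs ys where "take m l = xs @ e # ys" by (meson split_list)
  moreover from this have "length (xs @ e # ys) \<le> m" by (metis length_take min.cobounded2)
  ultimately show "\<exists>xs ys. l = xs @ e # ys \<and> length xs < m"
    by (intro exI[of _ xs] exI[of _ "ys @ drop m l"]) (use append_take_drop_id[of m l] in auto)
qed (auto simp: take_Cons')

lemma set_take_drop_conv_split:
  "e \<in> set (take m2 (drop m1 l)) \<longleftrightarrow> (\<exists>xs ys. l = xs @ e # ys \<and> m1 \<le> length xs \<and> length xs < m1 + m2)"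
proof
  assume "e \<in> set (take m2 (drop m1 l))"
  then obtain xs ys where *: "drop m1 l = xs @ e # ys" "length xs < m2" unfolding set_take_conv_split by blast
  hence "m1 < length l" by (metis append_is_Nil_conv drop_all leI list.distinct(1))
  thus "\<exists>xs ys. l = xs @ e # ys \<and> m1 \<le> length xs \<and> length xs < m1 + m2"
    using * append_take_drop_id[of m1 l] by (intro exI[of _ "take m1 l @ xs"] exI[of _ ys]) auto
qed (auto simp: take_Cons')

text \<open>Each phase lasts \<open>m\<close> edges. The numerical assumptions keep
  \<open>m - 3\<close> positive and make \<open>n choose 2 - 10\<close> at least half of
  \<open>n choose 2\<close>, whence \<open>q \<le> 1\<close>.\<close>

locale two_phase =
  fixes n m k r :: nat
  assumes fit: "k + r \<le> n"
    and m: "2 * m \<le> n choose 2" "m \<ge> 4"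
    and N: "n choose 2 \<ge> 20"
begin

definition centers :: "nat set" where "centers = {1..k}"
definition leaves :: "nat set" where "leaves = {k+1..k+r}"

definition first_phase :: "edge list \<Rightarrow> edge set" where "first_phase es = set (take m es)"
definition second_phase :: "edge list \<Rightarrow> edge set" where "second_phase es = set (take m (drop m es))"

definition star_edges :: "edge set" where
  "star_edges = {{v, x} |v x. v \<in> centers \<and> x \<in> leaves}"

definition closing_edges :: "edge set \<Rightarrow> edge set" where
  "closing_edges G = {{x, y} |x y. x \<in> leaves \<and> y \<in> leaves \<and> x \<noteq> y \<and> (\<exists>v\<in>centers. {v, x} \<in> G \<and> {v, y} \<in> G)}"

definition wants :: "edge list \<Rightarrow> edge \<Rightarrow> bool" where
  "wants xs e \<longleftrightarrow> (length xs < m \<and> e \<in> star_edges) \<or>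
     (m \<le> length xs \<and> length xs < m + m \<and> e \<in> closing_edges (set (take m xs)))"

lemma selected_wants:
  "selected wants es = (first_phase es \<inter> star_edges) \<union> (second_phase es \<inter> closing_edges (first_phase es))"
proof -
  have "e \<in> second_phase es \<inter> closing_edges (first_phase es) \<longleftrightarrow>
     (\<exists>xs ys. es = xs @ e # ys \<and> m \<le> length xs \<and> length xs < m + m \<and> e \<in> closing_edges (set (take m xs)))" for e
    unfolding second_phase_def first_phase_def Int_iff set_take_drop_conv_split by auto
  moreover have "e \<in> first_phase es \<inter> star_edges \<longleftrightarrow>
     (\<exists>xs ys. es = xs @ e # ys \<and> length xs < m \<and> e \<in> star_edges)" for e
    unfolding first_phase_def Int_iff set_take_conv_split by auto
  ultimately show ?thesis unfolding selected_def wants_def by blast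
qed

abbreviation "edges \<equiv> complete_edges n"
abbreviation "orders \<equiv> permutations_of_set edges"

text \<open>The probability that \<open>j \<le> 10\<close> given edges fall into their prescribed
  phases is at most \<open>q ^ j\<close>.\<close>

definition q :: real where "q = real m / (real (n choose 2) - 10)"

lemma q_pos: "0 < q"
proof -
  have "real (n choose 2) \<ge> 20" "real m > 0" using N m(2) by linarith+
  thus ?thesis unfolding q_def by (intro divide_pos_pos) linarith+
qed

lemma leaves_props [simp]: "finite leaves" "card leaves = r" "finite centers" "card centers = k"
  unfolding leaves_def centers_def by simp_all

lemma center_neq_leaf: "v \<in> centers \<Longrightarrow> x \<in> leaves \<Longrightarrow> v \<noteq> x"
  unfolding leaves_def centers_def atLeastAtMost_iff by linarith

lemma doubleton_in_edges:
  assumes "x \<in> centers \<union> leaves" "y \<in> centers \<union> leaves" "x \<noteq> y"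
  shows "{x, y} \<in> edges"
proof -
  have "x \<in> {1..n}" "y \<in> {1..n}"
    using assms fit unfolding leaves_def centers_def Un_iff atLeastAtMost_iff by linarith+
  thus ?thesis using assms(3) by (simp add: complete_edges_def)
qed

lemma star_edge: "v \<in> centers \<Longrightarrow> x \<in> leaves \<Longrightarrow> {v, x} \<in> edges"
  by (rule doubleton_in_edges) (auto dest: center_neq_leaf)

lemma leaf_edge: "x \<in> leaves \<Longrightarrow> y \<in> leaves \<Longrightarrow> x \<noteq> y \<Longrightarrow> {x, y} \<in> edges"
  by (rule doubleton_in_edges) auto

definition hits :: "edge set \<Rightarrow> edge set \<Rightarrow> edge list \<Rightarrow> bool" where
  "hits A B es \<longleftrightarrow> A \<subseteq> first_phase es \<and> B \<subseteq> second_phase es"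

lemma placements_hits: "placements edges m m A B = {es \<in> orders. hits A B es}"
  by (simp add: placements_def hits_def first_phase_def second_phase_def)

lemma prob_hits_le:
  assumes "A \<subseteq> edges" "B \<subseteq> edges" "A \<inter> B = {}" "card A + card B \<le> 10"
  shows "real (card {es \<in> orders. hits A B es}) \<le> fact (n choose 2) * q ^ (card A + card B)"
  using card_placements_le_power[of edges A B m] assms m N
  by (simp add: placements_hits card_complete_edges q_def pos_divide_le_eq mult.commute)

lemma prob_hits_ge:
  assumes "A \<subseteq> edges" "B \<subseteq> edges" "A \<inter> B = {}" "card A = 3" "card B = 2"
  shows "fact (n choose 2) * ((real m - 3) / real (n choose 2)) ^ 5 \<le> real (card {es \<in> orders. hits A B es})"
  using card_placements_ge_power[of edges A B m] assms m N
  by (simp add: placements_hits card_complete_edges pos_le_divide_eq mult.commute)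

section \<open>Expected spending\<close>

lemma sum_card_swap:
  assumes "finite I"
  shows "(\<Sum>es\<in>orders. real (card {i\<in>I. P i es})) = (\<Sum>i\<in>I. real (card {es\<in>orders. P i es}))"
proof -
  have "(\<Sum>es\<in>orders. real (card {i\<in>I. P i es})) = (\<Sum>es\<in>orders. \<Sum>i\<in>I. of_bool (P i es))"
    using assms by (simp add: Int_def)
  also have "\<dots> = (\<Sum>i\<in>I. \<Sum>es\<in>orders. of_bool (P i es))" by (rule sum.swap)
  also have "\<dots> = (\<Sum>i\<in>I. real (card {es\<in>orders. P i es}))" by (simp add: Int_def)
  finally show ?thesis .
qed

lemma card_selected_le:
  "card (selected wants es) \<le> card {(v, x) \<in> centers \<times> leaves. hits {{v, x}} {} es}
     + card {(v, x, y) \<in> centers \<times> leaves \<times> leaves. x \<noteq> y \<and> hits {{v, x}, {v, y}} {{x, y}} es}"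
proof -
  let ?S = "{(v, x) \<in> centers \<times> leaves. hits {{v, x}} {} es}"
  let ?T = "{(v, x, y) \<in> centers \<times> leaves \<times> leaves. x \<noteq> y \<and> hits {{v, x}, {v, y}} {{x, y}} es}"
  have fin: "finite ?S" "finite ?T"
    by (rule finite_subset[of _ "centers \<times> leaves"] finite_subset[of _ "centers \<times> leaves \<times> leaves"]; auto)+
  have "first_phase es \<inter> star_edges \<subseteq> (\<lambda>(v, x). {v, x}) ` ?S"
    by (force simp: star_edges_def hits_def)
  hence 1: "card (first_phase es \<inter> star_edges) \<le> card ?S" by (rule surj_card_le[OF fin(1)])
  have "second_phase es \<inter> closing_edges (first_phase es) \<subseteq> (\<lambda>(v, x, y). {x, y}) ` ?T"
    by (force simp: closing_edges_def hits_def)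
  hence 2: "card (second_phase es \<inter> closing_edges (first_phase es)) \<le> card ?T" by (rule surj_card_le[OF fin(2)])
  show ?thesis unfolding selected_wants using 1 2 by (intro order_trans[OF card_Un_le] add_mono)
qed

lemma budget_exceeded_le:
  assumes "b > 0"
  shows "real (card {es \<in> orders. \<not> card (selected wants es) \<le> b})
      \<le> fact (n choose 2) * ((real k * real r * q + real k * real r ^ 2 * q ^ 3) / real b)"
proof -
  let ?S = "{(v, x) \<in> centers \<times> leaves. True}"
  let ?T = "{(v, x, y) \<in> centers \<times> leaves \<times> leaves. x \<noteq> y}"
  let ?F = "fact (n choose 2) :: real"
  have fin: "finite ?S" "finite ?T"
    by (rule finite_subset[of _ "centers \<times> leaves"] finite_subset[of _ "centers \<times> leaves \<times> leaves"]; auto)+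
  have cS: "card ?S = k * r" by simp
  have cT: "card ?T \<le> k * r ^ 2"
    using card_mono[of "centers \<times> leaves \<times> leaves" ?T] by (auto simp: power2_eq_square)
  have S: "real (card {es \<in> orders. hits {{fst s, snd s}} {} es}) \<le> ?F * q" if "s \<in> ?S" for s
    using that prob_hits_le[of "{{fst s, snd s}}" "{}"] star_edge by auto
  have T: "real (card {es \<in> orders. hits {{fst s, fst (snd s)}, {fst s, snd (snd s)}} {{fst (snd s), snd (snd s)}} es}) \<le> ?F * q ^ 3"
    if s: "s \<in> ?T" for s
  proof -
    obtain v x y where s: "s = (v, x, y)" "v \<in> centers" "x \<in> leaves" "y \<in> leaves" "x \<noteq> y" using s by auto
    have "v \<noteq> x" "v \<noteq> y" using s center_neq_leaf by blast+
    thus ?thesis using prob_hits_le[of "{{v, x}, {v, y}}" "{{x, y}}"] s star_edge leaf_edge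
      by (auto simp: doubleton_eq_iff power3_eq_cube)
  qed
  \<comment> \<open>Markov's inequality, with all expectations multiplied by the number of
    orders.\<close>
  have "real b * real (card {es \<in> orders. \<not> card (selected wants es) \<le> b})
     = (\<Sum>es\<in>{es \<in> orders. \<not> card (selected wants es) \<le> b}. real b)" by simp
  also have "\<dots> \<le> (\<Sum>es\<in>{es \<in> orders. \<not> card (selected wants es) \<le> b}. real (card (selected wants es)))"
    by (intro sum_mono) auto
  also have "\<dots> \<le> (\<Sum>es\<in>orders. real (card (selected wants es)))"
    by (intro sum_mono2) auto
  also have "\<dots> \<le> (\<Sum>es\<in>orders. real (card {s\<in>?S. hits {{fst s, snd s}} {} es}) +
      real (card {s\<in>?T. hits {{fst s, fst (snd s)}, {fst s, snd (snd s)}} {{fst (snd s), snd (snd s)}} es}))"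
  proof (intro sum_mono)
    fix es
    have e1: "{(v, x) \<in> centers \<times> leaves. hits {{v, x}} {} es} = {s\<in>?S. hits {{fst s, snd s}} {} es}" by auto
    have e2: "{(v, x, y) \<in> centers \<times> leaves \<times> leaves. x \<noteq> y \<and> hits {{v, x}, {v, y}} {{x, y}} es}
       = {s\<in>?T. hits {{fst s, fst (snd s)}, {fst s, snd (snd s)}} {{fst (snd s), snd (snd s)}} es}" by auto
    show "real (card (selected wants es)) \<le> real (card {s\<in>?S. hits {{fst s, snd s}} {} es}) +
      real (card {s\<in>?T. hits {{fst s, fst (snd s)}, {fst s, snd (snd s)}} {{fst (snd s), snd (snd s)}} es})"
      using card_selected_le[of es] unfolding e1 e2 of_nat_add[symmetric] of_nat_le_iff .
  qed
  also have "\<dots> = (\<Sum>s\<in>?S. real (card {es \<in> orders. hits {{fst s, snd s}} {} es})) +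
     (\<Sum>s\<in>?T. real (card {es \<in> orders. hits {{fst s, fst (snd s)}, {fst s, snd (snd s)}} {{fst (snd s), snd (snd s)}} es}))"
    unfolding sum.distrib by (simp only: sum_card_swap[OF fin(1)] sum_card_swap[OF fin(2)])
  also have "\<dots> \<le> (\<Sum>s\<in>?S. ?F * q) + (\<Sum>s\<in>?T. ?F * q ^ 3)"
    by (intro add_mono sum_mono S T)
  also have "\<dots> = real (card ?S) * (?F * q) + real (card ?T) * (?F * q ^ 3)" by simp
  also have "\<dots> \<le> real (k * r) * (?F * q) + real (k * r ^ 2) * (?F * q ^ 3)"
    unfolding cS using cT q_pos by (intro add_left_mono mult_right_mono of_nat_mono) auto
  finally show ?thesis using assms by (simp add: field_simps)
qed

end

text \<open>The booleans tell whether the center and the three leaves of one copy occur as such in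
  another. The five pairs are the edges of the pattern; \<open>c\<close> and \<open>d\<close> stand
  for its non-adjacent vertices.\<close>

definition overlap :: "bool \<Rightarrow> bool \<Rightarrow> bool \<Rightarrow> bool \<Rightarrow> nat" where
  "overlap a b c d = of_bool (a \<and> b) + of_bool (a \<and> c) + of_bool (a \<and> d) + of_bool (b \<and> c) + of_bool (b \<and> d)"

lemma sum_membership_le:
  fixes f :: "bool \<Rightarrow> real"
  assumes "finite V" "finite S" "card S \<le> s" "0 \<le> f True" "0 \<le> f False"
  shows "(\<Sum>x\<in>V. f (x \<in> S)) \<le> real s * f True + real (card V) * f False"
proof -
  have "(\<Sum>x\<in>V. f (x \<in> S)) \<le> (\<Sum>x\<in>V. of_bool (x \<in> S) * f True + f False)"
    using assms by (intro sum_mono) auto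
  also have "\<dots> = real (card (V \<inter> S)) * f True + real (card V) * f False"
    using assms by (simp add: sum.distrib Int_def flip: sum_distrib_right)
  also have "\<dots> \<le> real s * f True + real (card V) * f False"
    using assms card_mono[of S "V \<inter> S"] by (intro add_right_mono mult_right_mono) auto
  finally show ?thesis .
qed

section \<open>Second moment of the number of copies\<close>

context two_phase
begin

text \<open>In \<open>(v, x, y, z)\<close> the vertices \<open>v\<close> and \<open>x\<close> have
  degree three and the pair \<open>y\<close>, \<open>z\<close> is the missing edge. Swapping
  \<open>y\<close> and \<open>z\<close> counts the same copy again.\<close>

definition tuples :: "(nat \<times> nat \<times> nat \<times> nat) set" where
  "tuples = {(v, x, y, z). v \<in> centers \<and> x \<in> leaves \<and> y \<in> leaves \<and> z \<in> leaves \<and> x \<noteq> y \<and> x \<noteq> z \<and> y \<noteq> z}"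

fun spokes :: "nat \<times> nat \<times> nat \<times> nat \<Rightarrow> edge set" where
  "spokes (v, x, y, z) = {{v, x}, {v, y}, {v, z}}"

fun rims :: "nat \<times> nat \<times> nat \<times> nat \<Rightarrow> edge set" where
  "rims (v, x, y, z) = {{x, y}, {x, z}}"

definition copies :: "edge list \<Rightarrow> (nat \<times> nat \<times> nat \<times> nat) set" where
  "copies es = {\<tau> \<in> tuples. hits (spokes \<tau>) (rims \<tau>) es}"

lemma tuples_subset: "tuples \<subseteq> centers \<times> leaves \<times> leaves \<times> leaves"
  by (auto simp: tuples_def)

lemma finite_tuples [simp]: "finite tuples"
  by (rule finite_subset[OF tuples_subset]) simp

lemma spokes_rims:
  assumes "\<tau> \<in> tuples"
  shows "spokes \<tau> \<subseteq> edges" "rims \<tau> \<subseteq> edges" "card (spokes \<tau>) = 3" "card (rims \<tau>) = 2"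
    "finite (spokes \<tau>)" "finite (rims \<tau>)"
proof -
  obtain v x y z where t: "\<tau> = (v, x, y, z)" "v \<in> centers" "x \<in> leaves" "y \<in> leaves" "z \<in> leaves"
    "x \<noteq> y" "x \<noteq> z" "y \<noteq> z"
    using assms unfolding tuples_def by blast
  have "v \<noteq> x" "v \<noteq> y" "v \<noteq> z" using t center_neq_leaf by blast+
  thus "spokes \<tau> \<subseteq> edges" "rims \<tau> \<subseteq> edges" "card (spokes \<tau>) = 3" "card (rims \<tau>) = 2"
    "finite (spokes \<tau>)" "finite (rims \<tau>)"
    using t star_edge leaf_edge by (auto simp: doubleton_eq_iff)
qed

text \<open>Rims contain no center. Hence two copies never require the same edge in both
  phases.\<close>

lemma spokes_rims_disjoint:
  assumes "\<tau> \<in> tuples" "\<tau>' \<in> tuples"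
  shows "spokes \<tau> \<inter> rims \<tau>' = {}"
proof -
  obtain v x y z where t: "\<tau> = (v, x, y, z)" "v \<in> centers"
    using assms unfolding tuples_def by blast
  obtain v' x' y' z' where t': "\<tau>' = (v', x', y', z')" "x' \<in> leaves" "y' \<in> leaves" "z' \<in> leaves"
    using assms unfolding tuples_def by blast
  have "v \<noteq> x'" "v \<noteq> y'" "v \<noteq> z'" using t t' center_neq_leaf by blast+
  thus ?thesis using t t' by (auto simp: doubleton_eq_iff)
qed

text \<open>Inclusion and exclusion: a common spoke forces the same center and a common leaf, a
  common rim forces both its ends to be common. So \<open>overlap\<close> is at least the number of
  shared edges.\<close>

lemma card_union_copies:
  assumes "(v, x, y, z) \<in> tuples" "(v', x', y', z') \<in> tuples"
  shows "10 \<le> card (spokes (v, x, y, z) \<union> spokes (v', x', y', z')) + card (rims (v, x, y, z) \<union> rims (v', x', y', z'))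
     + overlap (v' \<in> {v}) (x' \<in> {x, y, z}) (y' \<in> {x, y, z}) (z' \<in> {x, y, z})"
proof -
  let ?\<tau> = "(v, x, y, z)" and ?\<tau>' = "(v', x', y', z')" and ?S = "{x, y, z}"
  have mem: "v \<in> centers" "v' \<in> centers" "x \<in> leaves" "y \<in> leaves" "z \<in> leaves" "x' \<in> leaves" "y' \<in> leaves" "z' \<in> leaves"
    using assms by (auto simp: tuples_def)
  have ne: "v \<noteq> x'" "v \<noteq> y'" "v \<noteq> z'" using mem center_neq_leaf by blast+
  have "spokes ?\<tau> \<inter> spokes ?\<tau>' \<subseteq> (if v' = v \<and> x' \<in> ?S then {{v', x'}} else {}) \<union>
     (if v' = v \<and> y' \<in> ?S then {{v', y'}} else {}) \<union> (if v' = v \<and> z' \<in> ?S then {{v', z'}} else {})"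
    (is "_ \<subseteq> ?U1 \<union> ?U2 \<union> ?U3") using ne by (auto simp: doubleton_eq_iff)
  hence "card (spokes ?\<tau> \<inter> spokes ?\<tau>') \<le> card (?U1 \<union> ?U2 \<union> ?U3)" by (rule card_mono[rotated]) simp
  also have "\<dots> \<le> card ?U1 + card ?U2 + card ?U3"
    by (intro order_trans[OF card_Un_le] add_mono card_Un_le order_refl)
  also have "\<dots> = of_bool (v' = v \<and> x' \<in> ?S) + of_bool (v' = v \<and> y' \<in> ?S) + of_bool (v' = v \<and> z' \<in> ?S)"
    by (simp only: if_distrib[of card] card.empty card_1_singleton_iff) (simp add: of_bool_def)
  finally have 1: "card (spokes ?\<tau> \<inter> spokes ?\<tau>') \<le> of_bool (v' = v \<and> x' \<in> ?S) + of_bool (v' = v \<and> y' \<in> ?S) + of_bool (v' = v \<and> z' \<in> ?S)" .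
  have "rims ?\<tau> \<inter> rims ?\<tau>' \<subseteq> (if x' \<in> ?S \<and> y' \<in> ?S then {{x', y'}} else {}) \<union>
     (if x' \<in> ?S \<and> z' \<in> ?S then {{x', z'}} else {})"
    (is "_ \<subseteq> ?W1 \<union> ?W2") by (auto simp: doubleton_eq_iff)
  hence "card (rims ?\<tau> \<inter> rims ?\<tau>') \<le> card (?W1 \<union> ?W2)" by (rule card_mono[rotated]) simp
  also have "\<dots> \<le> card ?W1 + card ?W2" by (rule card_Un_le)
  also have "\<dots> = of_bool (x' \<in> ?S \<and> y' \<in> ?S) + of_bool (x' \<in> ?S \<and> z' \<in> ?S)"
    by (simp only: if_distrib[of card] card.empty) (simp add: of_bool_def)
  finally have 2: "card (rims ?\<tau> \<inter> rims ?\<tau>') \<le> of_bool (x' \<in> ?S \<and> y' \<in> ?S) + of_bool (x' \<in> ?S \<and> z' \<in> ?S)" .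
  note s = spokes_rims[OF assms(1)] spokes_rims[OF assms(2)]
  have 3: "card (spokes ?\<tau> \<union> spokes ?\<tau>') + card (spokes ?\<tau> \<inter> spokes ?\<tau>') = 6"
    using card_Un_Int[OF s(5) s(11)] s(3,9) by linarith
  have 4: "card (rims ?\<tau> \<union> rims ?\<tau>') + card (rims ?\<tau> \<inter> rims ?\<tau>') = 4"
    using card_Un_Int[OF s(6) s(12)] s(4,10) by linarith
  have "overlap (v' \<in> {v}) (x' \<in> ?S) (y' \<in> ?S) (z' \<in> ?S) = of_bool (v' = v \<and> x' \<in> ?S) + of_bool (v' = v \<and> y' \<in> ?S)
      + of_bool (v' = v \<and> z' \<in> ?S) + of_bool (x' \<in> ?S \<and> y' \<in> ?S) + of_bool (x' \<in> ?S \<and> z' \<in> ?S)"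
    unfolding overlap_def by simp
  thus ?thesis using 1 2 3 4 by linarith
qed

lemma q_le_1: "q \<le> 1"
proof -
  have "real (2 * m) \<le> real (n choose 2)" "real (n choose 2) \<ge> 20" using m(1) N by linarith+
  thus ?thesis unfolding q_def by (simp add: pos_divide_le_eq)
qed

lemma prob_two_copies_le:
  assumes "(v, x, y, z) \<in> tuples" "(v', x', y', z') \<in> tuples"
  shows "real (card {es \<in> orders. hits (spokes (v, x, y, z) \<union> spokes (v', x', y', z')) (rims (v, x, y, z) \<union> rims (v', x', y', z')) es})
     \<le> fact (n choose 2) * q ^ 10 * (1 / q) ^ overlap (v' \<in> {v}) (x' \<in> {x, y, z}) (y' \<in> {x, y, z}) (z' \<in> {x, y, z})"
proof -
  let ?A = "spokes (v, x, y, z) \<union> spokes (v', x', y', z')" and ?B = "rims (v, x, y, z) \<union> rims (v', x', y', z')"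
  let ?o = "overlap (v' \<in> {v}) (x' \<in> {x, y, z}) (y' \<in> {x, y, z}) (z' \<in> {x, y, z})"
  let ?c = "card ?A + card ?B"
  note s = spokes_rims[OF assms(1)] spokes_rims[OF assms(2)]
  have "?A \<subseteq> edges" "?B \<subseteq> edges" using s(1,2,7,8) by blast+
  moreover have "?A \<inter> ?B = {}"
    using spokes_rims_disjoint[OF assms(1) assms(1)] spokes_rims_disjoint[OF assms(1) assms(2)]
      spokes_rims_disjoint[OF assms(2) assms(1)] spokes_rims_disjoint[OF assms(2) assms(2)] by blast
  moreover have c10: "?c \<le> 10"
    using card_Un_le[of "spokes (v, x, y, z)" "spokes (v', x', y', z')"] card_Un_le[of "rims (v, x, y, z)" "rims (v', x', y', z')"]
      s(3,4,9,10) by linarith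
  ultimately have "real (card {es \<in> orders. hits ?A ?B es}) \<le> fact (n choose 2) * q ^ ?c"
    by (rule prob_hits_le)
  also have "q ^ ?c = q ^ 10 * (1 / q) ^ (10 - ?c)"
  proof -
    have "q ^ 10 = q ^ ?c * q ^ (10 - ?c)" using c10 by (simp flip: power_add)
    thus ?thesis using q_pos by (simp add: power_one_over)
  qed
  \<comment> \<open>Overcounting shared edges is harmless because
    \<open>1 / q \<ge> 1\<close>.\<close>
  also have "(1 / q) ^ (10 - ?c) \<le> (1 / q) ^ ?o"
    using card_union_copies[OF assms] q_le_1 q_pos by (intro power_increasing) auto
  finally show ?thesis using q_pos by (simp add: mult_left_mono mult.assoc)
qed

text \<open>The hypotheses say that each relevant common part has at least \<open>K\<close> expected
  occurrences: a spoke, a triangle, a whole copy, a rim, or both rims. Overlapping pairs then add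
  only a fraction \<open>108 / K\<close> to the disjoint ones.\<close>

lemma sum_overlap_le:
  fixes K :: real
  assumes "K > 0" "K \<le> real k * real r * q" "K \<le> real k * real r ^ 2 * q ^ 3" "K \<le> real k * real r ^ 3 * q ^ 5"
    and "K \<le> real r ^ 2 * q" "K \<le> real r ^ 3 * q ^ 2"
    and S: "finite S" "card S \<le> 3"
  shows "(\<Sum>(v', x', y', z')\<in>centers \<times> leaves \<times> leaves \<times> leaves.
        (1 / q) ^ overlap (v' \<in> {v}) (x' \<in> S) (y' \<in> S) (z' \<in> S)) \<le> real k * real r ^ 3 * (1 + 108 / K)"
proof -
  define \<rho> where "\<rho> = 1 / q"
  \<comment> \<open>\<open>g\<close> isolates the contribution of pairs that may share an edge; each
    pair contributes at most \<open>1 + g\<close>.\<close>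
  define g where "g a b c d = (if overlap a b c d = 0 then 0 else \<rho> ^ overlap a b c d)" for a b c d
  have \<rho>: "\<rho> \<ge> 1" using q_pos q_le_1 by (simp add: \<rho>_def)
  have g0: "0 \<le> g a b c d" for a b c d using \<rho> by (simp add: g_def)
  have "(\<Sum>(v', x', y', z')\<in>centers \<times> leaves \<times> leaves \<times> leaves. \<rho> ^ overlap (v' \<in> {v}) (x' \<in> S) (y' \<in> S) (z' \<in> S))
     \<le> (\<Sum>(v', x', y', z')\<in>centers \<times> leaves \<times> leaves \<times> leaves. 1 + g (v' \<in> {v}) (x' \<in> S) (y' \<in> S) (z' \<in> S))"
    by (intro sum_mono) (auto simp: g_def)
  also have "\<dots> = real k * real r ^ 3 +
      (\<Sum>(v', x', y', z')\<in>centers \<times> leaves \<times> leaves \<times> leaves. g (v' \<in> {v}) (x' \<in> S) (y' \<in> S) (z' \<in> S))"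
    by (simp add: case_prod_unfold sum.distrib power3_eq_cube)
  also have "(\<Sum>(v', x', y', z')\<in>centers \<times> leaves \<times> leaves \<times> leaves. g (v' \<in> {v}) (x' \<in> S) (y' \<in> S) (z' \<in> S))
     = (\<Sum>v'\<in>centers. \<Sum>x'\<in>leaves. \<Sum>y'\<in>leaves. \<Sum>z'\<in>leaves. g (v' \<in> {v}) (x' \<in> S) (y' \<in> S) (z' \<in> S))"
    by (simp add: sum.cartesian_product)
  \<comment> \<open>The coordinates are summed one at a time: at most three leaves lie in
    \<open>S\<close>, and at most \<open>r\<close> do not. \<open>g1\<close>, \<open>g2\<close> and
    \<open>g3\<close> record the results as functions of the coincidences still undecided.\<close>
  also have "\<dots> \<le> (\<Sum>v'\<in>centers. \<Sum>x'\<in>leaves. \<Sum>y'\<in>leaves. real 3 * g (v' \<in> {v}) (x' \<in> S) (y' \<in> S) True + real r * g (v' \<in> {v}) (x' \<in> S) (y' \<in> S) False)"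
  proof (intro sum_mono)
    fix v' x' y'
    show "(\<Sum>z'\<in>leaves. g (v' \<in> {v}) (x' \<in> S) (y' \<in> S) (z' \<in> S)) \<le> real 3 * g (v' \<in> {v}) (x' \<in> S) (y' \<in> S) True + real r * g (v' \<in> {v}) (x' \<in> S) (y' \<in> S) False"
      using sum_membership_le[of leaves S 3 "g (v' \<in> {v}) (x' \<in> S) (y' \<in> S)"] S g0 by simp
  qed
  also define g1 where "g1 a b c = real 3 * g a b c True + real r * g a b c False" for a b c
  have "(\<Sum>v'\<in>centers. \<Sum>x'\<in>leaves. \<Sum>y'\<in>leaves. real 3 * g (v' \<in> {v}) (x' \<in> S) (y' \<in> S) True + real r * g (v' \<in> {v}) (x' \<in> S) (y' \<in> S) False)
     = (\<Sum>v'\<in>centers. \<Sum>x'\<in>leaves. \<Sum>y'\<in>leaves. g1 (v' \<in> {v}) (x' \<in> S) (y' \<in> S))" by (simp add: g1_def)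
  also have g10: "0 \<le> g1 a b c" for a b c using g0 by (simp add: g1_def)
  have "(\<Sum>v'\<in>centers. \<Sum>x'\<in>leaves. \<Sum>y'\<in>leaves. g1 (v' \<in> {v}) (x' \<in> S) (y' \<in> S))
     \<le> (\<Sum>v'\<in>centers. \<Sum>x'\<in>leaves. real 3 * g1 (v' \<in> {v}) (x' \<in> S) True + real r * g1 (v' \<in> {v}) (x' \<in> S) False)"
  proof (intro sum_mono)
    fix v' x'
    show "(\<Sum>y'\<in>leaves. g1 (v' \<in> {v}) (x' \<in> S) (y' \<in> S)) \<le> real 3 * g1 (v' \<in> {v}) (x' \<in> S) True + real r * g1 (v' \<in> {v}) (x' \<in> S) False"
      using sum_membership_le[of leaves S 3 "g1 (v' \<in> {v}) (x' \<in> S)"] S g10 by simp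
  qed
  also define g2 where "g2 a b = real 3 * g1 a b True + real r * g1 a b False" for a b
  have "(\<Sum>v'\<in>centers. \<Sum>x'\<in>leaves. real 3 * g1 (v' \<in> {v}) (x' \<in> S) True + real r * g1 (v' \<in> {v}) (x' \<in> S) False)
     = (\<Sum>v'\<in>centers. \<Sum>x'\<in>leaves. g2 (v' \<in> {v}) (x' \<in> S))" by (simp add: g2_def)
  also have g20: "0 \<le> g2 a b" for a b using g10 by (simp add: g2_def)
  have "(\<Sum>v'\<in>centers. \<Sum>x'\<in>leaves. g2 (v' \<in> {v}) (x' \<in> S))
     \<le> (\<Sum>v'\<in>centers. real 3 * g2 (v' \<in> {v}) True + real r * g2 (v' \<in> {v}) False)"
  proof (intro sum_mono)
    fix v'
    show "(\<Sum>x'\<in>leaves. g2 (v' \<in> {v}) (x' \<in> S)) \<le> real 3 * g2 (v' \<in> {v}) True + real r * g2 (v' \<in> {v}) False"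
      using sum_membership_le[of leaves S 3 "g2 (v' \<in> {v})"] S g20 by simp
  qed
  also define g3 where "g3 a = real 3 * g2 a True + real r * g2 a False" for a
  have "(\<Sum>v'\<in>centers. real 3 * g2 (v' \<in> {v}) True + real r * g2 (v' \<in> {v}) False) = (\<Sum>v'\<in>centers. g3 (v' \<in> {v}))"
    by (simp only: g3_def)
  also have "\<dots> \<le> real 1 * g3 True + real (card centers) * g3 False"
    using g20 by (intro sum_membership_le) (auto simp: g3_def)
  \<comment> \<open>The six terms in order: all vertices common; center, \<open>x'\<close> and one
    more leaf; center and one leaf; center, \<open>y'\<close> and \<open>z'\<close>; all leaves but
    not the center; \<open>x'\<close> and one more leaf without the center.\<close>
  also have "\<dots> = 27 * \<rho> ^ 5 + 18 * (real r * \<rho> ^ 3) + 9 * (real r ^ 2 * \<rho>) + 9 * (real r * \<rho> ^ 2)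
      + 27 * (real k * \<rho> ^ 2) + 18 * (real k * real r * \<rho>)"
    unfolding g3_def g2_def g1_def g_def overlap_def leaves_props
    by (simp add: algebra_simps power2_eq_square power3_eq_cube eval_nat_numeral)
  also have "\<dots> \<le> 108 * (real k * real r ^ 3 / K)"
  proof -
    let ?D = "real k * real r ^ 3 / K"
    have q\<rho>: "q * \<rho> = 1" using q_pos by (simp add: \<rho>_def)
    \<comment> \<open>\<open>c\<close> counts the free vertices and \<open>M\<close> the pinned
      ones; together they make up \<open>k * r ^ 3\<close>.\<close>
    have le: "c * \<rho> ^ j \<le> ?D" if "K \<le> M * q ^ j" "M * c = real k * real r ^ 3" "0 \<le> c" for c M j
    proof -
      have "c * \<rho> ^ j * K \<le> c * \<rho> ^ j * (M * q ^ j)" using that \<rho> by (intro mult_left_mono) auto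
      also have "\<dots> = M * c * (q * \<rho>) ^ j" by (simp add: power_mult_distrib mult_ac)
      finally show ?thesis using assms(1) q\<rho> that by (simp add: pos_le_divide_eq)
    qed
    have 1: "1 * \<rho> ^ 5 \<le> ?D" by (rule le[of "real k * real r ^ 3"]) (use assms in auto)
    have 2: "real r * \<rho> ^ 3 \<le> ?D" by (rule le[of "real k * real r ^ 2"]) (use assms in \<open>auto simp: power2_eq_square power3_eq_cube\<close>)
    have 3: "real r ^ 2 * \<rho> ^ 1 \<le> ?D" by (rule le[of "real k * real r"]) (use assms in \<open>auto simp: power2_eq_square power3_eq_cube\<close>)
    \<comment> \<open>Two common spokes need no condition of their own: the triangle term dominates
      them.\<close>
    have "\<rho> ^ 2 \<le> \<rho> ^ 3" using \<rho> by (intro power_increasing) auto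
    hence 4: "real r * \<rho> ^ 2 \<le> ?D" using 2 by (meson mult_left_mono of_nat_0_le_iff order_trans)
    have 5: "real k * \<rho> ^ 2 \<le> ?D" by (rule le[of "real r ^ 3"]) (use assms in auto)
    have 6: "real k * real r * \<rho> ^ 1 \<le> ?D" by (rule le[of "real r ^ 2"]) (use assms in \<open>auto simp: power2_eq_square power3_eq_cube\<close>)
    have lin: "27 * a + 18 * b + 9 * c + 9 * d + 27 * e + 18 * f \<le> 108 * D"
      if "a \<le> D" "b \<le> D" "c \<le> D" "d \<le> D" "e \<le> D" "f \<le> D" for a b c d e f D :: real
      using that by linarith
    show ?thesis using lin[OF 1 2 3 4 5 6] unfolding power_one_right mult_1 .
  qed
  finally show ?thesis unfolding \<rho>_def by (simp add: algebra_simps)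
qed

lemma card_tuples_ge: "real (card tuples) \<ge> real k * real r ^ 3 - 3 * (real k * real r ^ 2)"
proof -
  let ?all = "centers \<times> leaves \<times> leaves \<times> leaves"
  let ?X = "(\<lambda>(v, x, y). (v, x, x, y)) ` (centers \<times> leaves \<times> leaves)"
  let ?Y = "(\<lambda>(v, x, y). (v, x, y, x)) ` (centers \<times> leaves \<times> leaves)"
  let ?Z = "(\<lambda>(v, x, y). (v, y, x, x)) ` (centers \<times> leaves \<times> leaves)"
  have c: "card (centers \<times> leaves \<times> leaves) = k * r ^ 2" by (simp add: power2_eq_square)
  have "?all \<subseteq> tuples \<union> (?X \<union> ?Y \<union> ?Z)" by (auto simp: tuples_def image_iff)
  hence "card ?all \<le> card (tuples \<union> (?X \<union> ?Y \<union> ?Z))" by (rule card_mono[rotated]) simp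
  also have "\<dots> \<le> card tuples + (card ?X + card ?Y + card ?Z)"
    by (intro order_trans[OF card_Un_le] add_mono card_Un_le order_refl)
  also have "\<dots> \<le> card tuples + (k * r ^ 2 + k * r ^ 2 + k * r ^ 2)"
    unfolding c[symmetric] by (intro add_mono card_image_le order_refl) simp_all
  finally have "k * r ^ 3 \<le> card tuples + 3 * (k * r ^ 2)" by (simp add: power3_eq_cube)
  hence "real (k * r ^ 3) \<le> real (card tuples + 3 * (k * r ^ 2))" by (simp only: of_nat_le_iff)
  thus ?thesis by simp
qed

lemma hits_Un: "hits (A \<union> A') (B \<union> B') es \<longleftrightarrow> hits A B es \<and> hits A' B' es"
  by (auto simp: hits_def)

lemma sum_copies_ge:
  "fact (n choose 2) * (real (card tuples) * ((real m - 3) / real (n choose 2)) ^ 5) \<le> (\<Sum>es\<in>orders. real (card (copies es)))"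
proof -
  have "fact (n choose 2) * (real (card tuples) * ((real m - 3) / real (n choose 2)) ^ 5)
     = (\<Sum>\<tau>\<in>tuples. fact (n choose 2) * ((real m - 3) / real (n choose 2)) ^ 5)" by simp
  also have "\<dots> \<le> (\<Sum>\<tau>\<in>tuples. real (card {es\<in>orders. hits (spokes \<tau>) (rims \<tau>) es}))"
    using spokes_rims spokes_rims_disjoint by (intro sum_mono prob_hits_ge) auto
  also have "\<dots> = (\<Sum>es\<in>orders. real (card (copies es)))"
    unfolding copies_def by (rule sum_card_swap[symmetric]) simp
  finally show ?thesis .
qed

lemma sum_copies_squared_le:
  fixes K :: real
  assumes "K > 0" "K \<le> real k * real r * q" "K \<le> real k * real r ^ 2 * q ^ 3" "K \<le> real k * real r ^ 3 * q ^ 5"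
    and "K \<le> real r ^ 2 * q" "K \<le> real r ^ 3 * q ^ 2"
  shows "(\<Sum>es\<in>orders. real (card (copies es)) ^ 2)
     \<le> fact (n choose 2) * (real (card tuples) * (q ^ 10 * (real k * real r ^ 3 * (1 + 108 / K))))"
proof -
  let ?F = "fact (n choose 2) :: real"
  let ?P = "\<lambda>\<tau> \<tau>' es. hits (spokes \<tau> \<union> spokes \<tau>') (rims \<tau> \<union> rims \<tau>') es"
  have one: "(\<Sum>\<tau>'\<in>tuples. real (card {es\<in>orders. ?P \<tau> \<tau>' es})) \<le> ?F * q ^ 10 * (real k * real r ^ 3 * (1 + 108 / K))"
    if t: "\<tau> \<in> tuples" for \<tau>
  proof -
    obtain v x y z where \<tau>: "\<tau> = (v, x, y, z)" by (cases \<tau>)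
    let ?o = "\<lambda>(v', x', y', z'). (1 / q) ^ overlap (v' \<in> {v}) (x' \<in> {x, y, z}) (y' \<in> {x, y, z}) (z' \<in> {x, y, z})"
    have "(\<Sum>\<tau>'\<in>tuples. real (card {es\<in>orders. ?P \<tau> \<tau>' es})) \<le> (\<Sum>\<tau>'\<in>tuples. ?F * q ^ 10 * ?o \<tau>')"
    proof (rule sum_mono)
      fix \<tau>' assume t': "\<tau>' \<in> tuples"
      obtain v' x' y' z' where \<tau>': "\<tau>' = (v', x', y', z')" by (cases \<tau>')
      show "real (card {es\<in>orders. ?P \<tau> \<tau>' es}) \<le> ?F * q ^ 10 * ?o \<tau>'"
        using prob_two_copies_le t t' unfolding \<tau> \<tau>' prod.case by blast
    qed
    \<comment> \<open>Forgetting that the leaves are distinct turns the index set into a product,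
      over which the sum can be taken coordinatewise.\<close>
    also have "\<dots> \<le> (\<Sum>\<tau>'\<in>centers \<times> leaves \<times> leaves \<times> leaves. ?F * q ^ 10 * ?o \<tau>')"
      using q_pos by (intro sum_mono2 tuples_subset) auto
    also have "\<dots> = ?F * q ^ 10 * (\<Sum>\<tau>'\<in>centers \<times> leaves \<times> leaves \<times> leaves. ?o \<tau>')"
      by (rule sum_distrib_left[symmetric])
    also have "\<dots> \<le> ?F * q ^ 10 * (real k * real r ^ 3 * (1 + 108 / K))"
      using q_pos by (intro mult_left_mono sum_overlap_le assms) (auto simp: card_insert_if)
    finally show ?thesis .
  qed
  have "(\<Sum>es\<in>orders. real (card (copies es)) ^ 2)
     = (\<Sum>es\<in>orders. real (card {p\<in>tuples \<times> tuples. ?P (fst p) (snd p) es}))"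
  proof (rule sum.cong[OF refl])
    fix es
    have "{p\<in>tuples \<times> tuples. ?P (fst p) (snd p) es} = copies es \<times> copies es"
      unfolding hits_Un copies_def by auto
    thus "real (card (copies es)) ^ 2 = real (card {p\<in>tuples \<times> tuples. ?P (fst p) (snd p) es})"
      by (simp only: card_cartesian_product) (simp add: power2_eq_square)
  qed
  also have "\<dots> = (\<Sum>p\<in>tuples \<times> tuples. real (card {es\<in>orders. ?P (fst p) (snd p) es}))"
    by (rule sum_card_swap) simp
  also have "\<dots> = (\<Sum>\<tau>\<in>tuples. \<Sum>\<tau>'\<in>tuples. real (card {es\<in>orders. ?P \<tau> \<tau>' es}))"
    by (simp only: sum.cartesian_product case_prod_unfold)
  also have "\<dots> \<le> (\<Sum>\<tau>\<in>tuples. ?F * q ^ 10 * (real k * real r ^ 3 * (1 + 108 / K)))"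
    by (intro sum_mono one)
  also have "\<dots> = ?F * (real (card tuples) * (q ^ 10 * (real k * real r ^ 3 * (1 + 108 / K))))" by simp
  finally show ?thesis .
qed

lemma exists_copy_ge:
  fixes K :: real
  assumes K: "K > 3" "K \<le> real r"
    and cond: "K \<le> real k * real r * q" "K \<le> real k * real r ^ 2 * q ^ 3" "K \<le> real k * real r ^ 3 * q ^ 5"
      "K \<le> real r ^ 2 * q" "K \<le> real r ^ 3 * q ^ 2"
  shows "fact (n choose 2) * ((1 - 3 / K) * ((real m - 3) / real (n choose 2) / q) ^ 10 / (1 + 108 / K))
      \<le> real (card {es \<in> orders. copies es \<noteq> {}})"
proof -
  let ?F = "fact (n choose 2) :: real" and ?l = "(real m - 3) / real (n choose 2)"
  let ?T = "real (card tuples)" and ?M = "real k * real r ^ 3 * (1 + 108 / K)"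
  let ?P = "real (card {es \<in> orders. copies es \<noteq> {}})"
  have l0: "?l \<ge> 0" using m(2) by simp
  have k0: "k > 0" using cond(1) K(1) by (cases k) auto
  have r0: "real r > 0" using K by linarith
  have kr: "real k * real r ^ 3 > 0" using k0 r0 by simp
  have T: "?T \<ge> real k * real r ^ 3 * (1 - 3 / K)"
  proof -
    have "real k * real r ^ 3 * (1 - 3 / K) \<le> real k * real r ^ 3 * (1 - 3 / real r)"
      using kr K r0 by (intro mult_left_mono) (auto simp: field_simps)
    also have "\<dots> = real k * real r ^ 3 - 3 * (real k * real r ^ 2)"
      using r0 by (simp add: field_simps power3_eq_cube power2_eq_square)
    also have "\<dots> \<le> ?T" by (rule card_tuples_ge)
    finally show ?thesis .
  qed
  moreover have "real k * real r ^ 3 * (1 - 3 / K) > 0" using kr K by simp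
  ultimately have T0: "?T > 0" by linarith
  have M0: "?M > 0" using kr K by (simp add: add_pos_pos)
  have "(?F * (?T * ?l ^ 5))\<^sup>2 \<le> (\<Sum>es\<in>orders. real (card (copies es)))\<^sup>2"
    using l0 by (intro power_mono sum_copies_ge mult_nonneg_nonneg) auto
  \<comment> \<open>Inserting the indicator of a nonzero count prepares Cauchy-Schwarz in the form
    \<open>(E X)^2 \<le> E(X^2) * P(X > 0)\<close>.\<close>
  also have "(\<Sum>es\<in>orders. real (card (copies es))) = (\<Sum>es\<in>orders. real (card (copies es)) * of_bool (copies es \<noteq> {}))"
    by (intro sum.cong) auto
  also have "\<dots>\<^sup>2 \<le> (\<Sum>es\<in>orders. (real (card (copies es)))\<^sup>2) * (\<Sum>es\<in>orders. (of_bool (copies es \<noteq> {}))\<^sup>2)"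
    by (rule Cauchy_Schwarz_ineq_sum)
  also have "(\<Sum>es\<in>orders. (of_bool (copies es \<noteq> {}))\<^sup>2) = (\<Sum>es\<in>orders. of_bool (copies es \<noteq> {}) :: real)"
    by (intro sum.cong) auto
  also have "\<dots> = ?P" by (simp add: Int_def)
  also have "(\<Sum>es\<in>orders. (real (card (copies es)))\<^sup>2) * ?P \<le> (?F * (?T * (q ^ 10 * ?M))) * ?P"
    using K cond by (intro mult_right_mono sum_copies_squared_le) auto
  finally have "(?F * ?T) * (?F * (?T * ?l ^ 10)) \<le> (?F * ?T) * (q ^ 10 * ?M * ?P)"
    by (simp add: power_mult_distrib power2_eq_square mult_ac flip: power_mult power_add)
  \<comment> \<open>One factor \<open>?T\<close> cancels because the second moment bound kept it
    exactly; only the other one is estimated from below.\<close>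
  hence up: "?F * (?T * ?l ^ 10) \<le> q ^ 10 * ?M * ?P"
    using T0 by (simp add: mult_le_cancel_left_pos)
  have "?F * (real k * real r ^ 3 * (1 - 3 / K) * ?l ^ 10) \<le> ?F * (?T * ?l ^ 10)"
    using T l0 by (intro mult_left_mono mult_right_mono) auto
  also note up
  also have "q ^ 10 * ?M * ?P = ?P * (q ^ 10 * ?M)" by (rule mult.commute)
  finally have "?F * (real k * real r ^ 3 * (1 - 3 / K) * ?l ^ 10) / (q ^ 10 * ?M) \<le> ?P"
    using M0 q_pos by (subst pos_divide_le_eq) auto
  moreover have "?F * (real k * real r ^ 3 * (1 - 3 / K) * ?l ^ 10) / (q ^ 10 * ?M)
     = ?F * ((1 - 3 / K) * (?l / q) ^ 10 / (1 + 108 / K))"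
    unfolding power_divide[of ?l q] using k0 r0 by simp
  ultimately show ?thesis by simp
qed

text \<open>Nothing is wanted after both phases, so a possible odd last edge does not
  matter.\<close>

lemma selected_take: "2 * m \<le> t \<Longrightarrow> selected wants (take t es) = selected wants es"
  by (simp add: selected_wants first_phase_def second_phase_def drop_take min_def)

lemma copy_in_selected:
  assumes "copies es \<noteq> {}"
  shows "contains_copy ({1..n}, selected wants es) K4_minus"
proof -
  obtain \<tau> where "\<tau> \<in> tuples" "hits (spokes \<tau>) (rims \<tau>) es"
    using assms unfolding copies_def by blast
  then obtain v x y z where t: "(v, x, y, z) \<in> tuples" "hits (spokes (v, x, y, z)) (rims (v, x, y, z)) es"
    by (cases \<tau>) blast
  hence mem: "v \<in> centers" "x \<in> leaves" "y \<in> leaves" "z \<in> leaves" "x \<noteq> y" "x \<noteq> z" "y \<noteq> z"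
    by (auto simp: tuples_def)
  have ne: "v \<noteq> x" "v \<noteq> y" "v \<noteq> z" using mem center_neq_leaf by blast+
  have "{v, x, y, z} \<subseteq> {1..n}"
    using mem fit unfolding leaves_def centers_def by auto
  have h: "{v, x} \<in> first_phase es" "{v, y} \<in> first_phase es" "{v, z} \<in> first_phase es"
    "{x, y} \<in> second_phase es" "{x, z} \<in> second_phase es"
    using t(2) by (auto simp: hits_def)
  have "{v, x} \<in> star_edges" "{v, y} \<in> star_edges" "{v, z} \<in> star_edges"
    unfolding star_edges_def using mem by blast+
  moreover have "{x, y} \<in> closing_edges (first_phase es)" "{x, z} \<in> closing_edges (first_phase es)"
    unfolding closing_edges_def using mem h by blast+
  ultimately have sel: "{v, x} \<in> selected wants es" "{v, y} \<in> selected wants es" "{v, z} \<in> selected wants es"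
    "{x, y} \<in> selected wants es" "{x, z} \<in> selected wants es"
    unfolding selected_wants using h by blast+
  \<comment> \<open>The non-adjacent vertices 3 and 4 of \<open>K4_minus\<close> go to
    \<open>y\<close> and \<open>z\<close>.\<close>
  let ?f = "\<lambda>i::nat. if i = 1 then v else if i = 2 then x else if i = 3 then y else z"
  show ?thesis unfolding contains_copy_def
  proof (intro exI[of _ ?f] conjI)
    show "inj_on ?f (fst K4_minus)" using mem ne by (auto simp: K4_minus_def inj_on_def)
    show "?f ` fst K4_minus \<subseteq> fst ({1..n}, selected wants es)"
      using \<open>{v, x, y, z} \<subseteq> {1..n}\<close> by (auto simp: K4_minus_def)
    show "\<forall>e\<in>snd K4_minus. ?f ` e \<in> snd ({1..n}, selected wants es)"
      using sel by (simp add: K4_minus_def insert_commute)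
  qed
qed

text \<open>The budget is \<open>K\<close> times the expected spending, so overspending removes at
  most \<open>1 / K\<close> from the probability of finding a copy.\<close>

lemma exists_good_strategy:
  fixes K :: real
  assumes "K > 3" "K \<le> real r"
    and "K \<le> real k * real r * q" "K \<le> real k * real r ^ 2 * q ^ 3" "K \<le> real k * real r ^ 3 * q ^ 5"
      "K \<le> real r ^ 2 * q" "K \<le> real r ^ 3 * q ^ 2"
    and "2 * m \<le> t" "b > 0" "K * (real k * real r * q + real k * real r ^ 2 * q ^ 3) \<le> real b"
  shows "\<exists>B. is_strategy n t b B \<and>
    (1 - 3 / K) * ((real m - 3) / real (n choose 2) / q) ^ 10 / (1 + 108 / K) - 1 / K \<le> prob_K4_minus n t B"
proof -
  let ?F = "fact (n choose 2) :: real"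
  let ?L = "(1 - 3 / K) * ((real m - 3) / real (n choose 2) / q) ^ 10 / (1 + 108 / K)"
  let ?good = "{es \<in> orders. card (selected wants (take t es)) \<le> b \<and> contains_copy ({1..n}, selected wants (take t es)) K4_minus}"
  let ?X = "{es \<in> orders. copies es \<noteq> {}}" and ?Z = "{es \<in> orders. \<not> card (selected wants es) \<le> b}"
  have "?X \<subseteq> ?good \<union> ?Z" using copy_in_selected assms(8) by (auto simp: selected_take)
  hence "card ?X \<le> card (?good \<union> ?Z)" by (intro card_mono) auto
  also have "\<dots> \<le> card ?good + card ?Z" by (rule card_Un_le)
  finally have "real (card ?X) \<le> real (card ?good) + real (card ?Z)" by (simp only: flip: of_nat_add of_nat_le_iff)
  moreover have "?F * ?L \<le> real (card ?X)" using assms by (intro exists_copy_ge)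
  moreover have "real (card ?Z) \<le> ?F * (1 / K)"
  proof -
    have "(real k * real r * q + real k * real r ^ 2 * q ^ 3) / real b \<le> 1 / K"
      using assms by (simp add: field_simps)
    hence "?F * ((real k * real r * q + real k * real r ^ 2 * q ^ 3) / real b) \<le> ?F * (1 / K)"
      by (rule mult_left_mono) simp
    thus ?thesis using budget_exceeded_le[OF assms(9)] by linarith
  qed
  ultimately have "?F * ?L - ?F * (1 / K) \<le> real (card ?good)" by linarith
  hence "?F * (?L - 1 / K) \<le> real (card ?good)" by (simp only: right_diff_distrib)
  hence "?L - 1 / K \<le> real (card ?good) / ?F" by (simp add: pos_le_divide_eq mult.commute)
  thus ?thesis using exists_strategy_selecting[of n t b wants] by (meson order_trans)
qed

end

section \<open>Choice of parameters\<close>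

text \<open>One star, with \<open>r\<close> about \<open>K * u ^ 5\<close> where
  \<open>u = q^(-1/3)\<close>. The parameter \<open>\<beta>\<close> stands for the second term of
  \<open>b_star\<close>, comparable to \<open>u ^ 2\<close>.\<close>

lemma dense_parameters:
  fixes K u q \<beta> :: real
  assumes K: "K \<ge> 4" and u: "u \<ge> 1" "q * u ^ 3 = 1" and small: "4 * (K * u ^ 5) \<le> real n"
    and \<beta>: "u ^ 2 \<le> 2 * \<beta>"
  shows "\<exists>r. 1 + r \<le> n \<and> K \<le> real r \<and> K \<le> real r * q \<and> K \<le> real r ^ 2 * q ^ 3 \<and> K \<le> real r ^ 3 * q ^ 5 \<and>
     K \<le> real r ^ 2 * q \<and> K \<le> real r ^ 3 * q ^ 2 \<and> real r * q + real r ^ 2 * q ^ 3 \<le> 12 * K ^ 2 * \<beta>"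
proof -
  define r where "r = nat \<lceil>K * u ^ 5\<rceil>"
  have q: "q = 1 / u ^ 3" using u by (simp add: field_simps)
  have upow: "u ^ j \<ge> 1" for j using u by simp
  have Ku: "K * u ^ j \<ge> K" for j using upow[of j] K by simp
  have r1: "K * u ^ 5 \<le> real r" unfolding r_def by linarith
  have "real r \<le> K * u ^ 5 + 1" unfolding r_def using Ku[of 5] K by linarith
  hence r2: "real r \<le> 2 * (K * u ^ 5)" using Ku[of 5] K by linarith
  have KK: "K \<le> K ^ j" if "j > 0" for j using K that by (simp add: self_le_power)
  have q0: "0 < q" using u q by simp
  have lower: "K ^ i * (u ^ (5 * i) * q ^ j) \<le> real r ^ i * q ^ j" for i j
  proof -
    have "(K * u ^ 5) ^ i * q ^ j \<le> real r ^ i * q ^ j"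
      using r1 K u q0 by (intro mult_right_mono power_mono) auto
    thus ?thesis by (simp add: power_mult_distrib power_mult mult.assoc)
  qed
  \<comment> \<open>In terms of \<open>u\<close> the product is at least
    \<open>K ^ i * u ^ (5 * i - 3 * j)\<close>. The exponent vanishes exactly for the whole copy,
    \<open>i = 3\<close> and \<open>j = 5\<close>.\<close>
  have ge: "K \<le> real r ^ i * q ^ j" if "i > 0" "3 * j \<le> 5 * i" for i j
  proof -
    have "u ^ (5 * i) * q ^ j = u ^ (5 * i - 3 * j)"
      unfolding q power_one_over[symmetric] using that u by (simp add: power_divide power_diff flip: power_mult)
    hence "1 \<le> u ^ (5 * i) * q ^ j" using upow by simp
    hence "K ^ i \<le> K ^ i * (u ^ (5 * i) * q ^ j)" using K by simp
    thus ?thesis using lower[of i j] KK[OF that(1)] by linarith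
  qed
  have "1 + real r \<le> real n" using r2 small Ku[of 5] K by linarith
  hence fit: "1 + r \<le> n" by linarith
  have budget: "real r * q + real r ^ 2 * q ^ 3 \<le> 12 * K ^ 2 * \<beta>"
  proof -
    have "real r * q \<le> 2 * (K * u ^ 5) * q" using r2 q0 by (intro mult_right_mono) auto
    also have "\<dots> = 2 * K * u ^ 2" using u by (simp add: q field_simps flip: power_add)
    also have "\<dots> \<le> 2 * K ^ 2 * u ^ 2" using KK[of 2] u by (intro mult_right_mono) auto
    finally have 1: "real r * q \<le> 2 * K ^ 2 * u ^ 2" .
    have "real r ^ 2 * q ^ 3 \<le> (2 * (K * u ^ 5)) ^ 2 * q ^ 3" using r2 q0 by (intro mult_right_mono power_mono) auto
    also have "\<dots> = 4 * K ^ 2 * u" using u by (simp add: q field_simps eval_nat_numeral)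
    also have "\<dots> \<le> 4 * K ^ 2 * u ^ 2" using u by (intro mult_left_mono) (auto simp: self_le_power)
    finally have "real r * q + real r ^ 2 * q ^ 3 \<le> 6 * K ^ 2 * u ^ 2" using 1 by simp
    also have "\<dots> \<le> 6 * K ^ 2 * (2 * \<beta>)" using \<beta> by (intro mult_left_mono) auto
    finally show ?thesis by simp
  qed
  show ?thesis
    using fit budget ge[of 1 0] ge[of 1 1] ge[of 2 3] ge[of 3 5] ge[of 2 1] ge[of 3 2] by (intro exI[of _ r]) auto
qed

text \<open>\<open>T\<close> stands for the number of revealed edges, and \<open>small\<close>
  expresses that the single star of \<open>dense_parameters\<close> would be too large. Half of the
  vertices serve as leaves and \<open>k\<close> is about \<open>L / w\<close>.\<close>

lemma sparse_parameters:
  fixes K q L :: real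
  assumes K: "K \<ge> 4" and L: "L = (4 * K) ^ 4" and q: "0 < q" and n: "(4 * K) ^ 6 \<le> real n"
    and small: "real n ^ 3 * q ^ 5 \<le> (4 * K) ^ 3"
    and T: "T \<le> 2 * (q * real n ^ 2)" "128 * L * real n ^ 6 \<le> T ^ 5" "real n \<le> T"
  shows "\<exists>k r. k + r \<le> n \<and> K \<le> real r \<and> K \<le> real k * real r * q \<and> K \<le> real k * real r ^ 2 * q ^ 3 \<and>
     K \<le> real k * real r ^ 3 * q ^ 5 \<and> K \<le> real r ^ 2 * q \<and> K \<le> real r ^ 3 * q ^ 2 \<and>
     real k * real r * q + real k * real r ^ 2 * q ^ 3 \<le> 64 * L * (real n ^ 6 / T ^ 4)"
proof -
  let ?n = "real n"
  \<comment> \<open>Up to a constant, \<open>w\<close> is the expected number of copies from one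
    full star.\<close>
  define w where "w = ?n ^ 3 * q ^ 5"
  define k where "k = nat \<lceil>L / w\<rceil>"
  define r where "r = n div 2"
  have nK: "108 * K \<le> ?n"
  proof -
    have "108 * K \<le> 4096 * K * 1" using K by simp
    also have "\<dots> \<le> 4096 * K * K ^ 5" using K by (intro mult_left_mono) auto
    also have "\<dots> = (4 * K) ^ 6" by (simp add: power_mult_distrib eval_nat_numeral)
    finally show ?thesis using n by linarith
  qed
  have n0: "?n > 0" using nK K by linarith
  have w0: "w > 0" using n0 q by (simp add: w_def)
  have LK: "27 * K \<le> L"
  proof -
    have "27 * K \<le> 256 * K * 1" using K by simp
    also have "\<dots> \<le> 256 * K * K ^ 3" using K by (intro mult_left_mono) auto
    also have "\<dots> = L" by (simp add: L power_mult_distrib eval_nat_numeral)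
    finally show ?thesis .
  qed
  have L0: "L > 0" using LK K by linarith
  \<comment> \<open>Since \<open>L\<close> exceeds the bound on \<open>w\<close>, rounding
    \<open>L / w\<close> up costs at most a factor 2.\<close>
  have Lw1: "1 \<le> L / w"
  proof -
    have "w \<le> (4 * K) ^ 3" using small by (simp add: w_def)
    also have "\<dots> \<le> L" unfolding L using K by (intro power_increasing) auto
    finally show ?thesis using w0 by simp
  qed
  have k1: "L / w \<le> real k" unfolding k_def by linarith
  have k2: "real k \<le> 2 * (L / w)" unfolding k_def using Lw1 by linarith
  have r1: "?n / 3 \<le> real r"
  proof -
    have "n \<le> 3 * r" unfolding r_def using nK K by linarith
    thus ?thesis by linarith
  qed
  have r2: "real r \<le> ?n / 2" unfolding r_def by linarith
  have T0: "T > 0" using T n0 by linarith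
  have qT: "T / (2 * ?n ^ 2) \<le> q" using T n0 by (simp add: field_simps)
  \<comment> \<open>Here \<open>n \<ge> (4 * K) ^ 6\<close> enters. The estimate makes closing edges
    no more expensive than spokes, and the spoke and triangle counts no smaller than the copy count
    up to constants.\<close>
  have nq2: "?n * q ^ 2 \<le> 1"
  proof -
    have "(?n * q ^ 2) ^ 5 * ?n = w ^ 2" by (simp add: w_def power_mult_distrib eval_nat_numeral)
    also have "\<dots> \<le> ((4 * K) ^ 3) ^ 2" using small w0 by (intro power_mono) (auto simp: w_def)
    also have "\<dots> = (4 * K) ^ 6" by (simp flip: power_mult)
    also have "\<dots> \<le> 1 * ?n" using n by simp
    finally have "(?n * q ^ 2) ^ 5 \<le> 1" using n0 by (rule mult_right_le_imp_le)
    thus ?thesis using n0 q by (simp add: power_le_one_iff)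
  qed
  have n2q4: "?n ^ 2 * q ^ 4 \<le> 1"
  proof -
    have "?n ^ 2 * q ^ 4 = (?n * q ^ 2) ^ 2" by (simp add: power_mult_distrib flip: power_mult)
    also have "\<dots> \<le> 1" using nq2 n0 q by (intro power_le_one) auto
    finally show ?thesis .
  qed
  have low: "(L / w) * ((?n / 3) ^ i * q ^ j) \<le> real k * (real r ^ i * q ^ j)" for i j
    using k1 r1 q L0 w0 by (intro mult_mono power_mono) auto
  have up: "real k * (real r ^ i * q ^ j) \<le> 2 * (L / w) * (?n ^ i * q ^ j)" for i j
    using k2 r2 q L0 w0 by (intro mult_mono power_mono) auto
  have c5: "K \<le> real k * (real r ^ 3 * q ^ 5)"
  proof -
    have "(L / w) * ((?n / 3) ^ 3 * q ^ 5) = L / 27" using n0 q by (simp add: w_def field_simps)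
    thus ?thesis using low[of 3 5] LK by linarith
  qed
  have c3: "K \<le> real k * (real r ^ 2 * q ^ 3)"
  proof -
    have "(L / w) * ((?n / 3) ^ 2 * q ^ 3) = (L / 9) / (?n * q ^ 2)"
      using n0 q by (simp add: w_def field_simps eval_nat_numeral)
    moreover have "L / 9 \<le> (L / 9) / (?n * q ^ 2)"
      using nq2 n0 q L0 by (simp add: pos_le_divide_eq mult_left_le)
    ultimately show ?thesis using low[of 2 3] LK K by linarith
  qed
  have c1: "K \<le> real k * (real r ^ 1 * q ^ 1)"
  proof -
    have "(L / w) * ((?n / 3) ^ 1 * q ^ 1) = (L / 3) / (?n ^ 2 * q ^ 4)"
      using n0 q by (simp add: w_def field_simps eval_nat_numeral)
    moreover have "L / 3 \<le> (L / 3) / (?n ^ 2 * q ^ 4)"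
      using n2q4 n0 q L0 by (simp add: pos_le_divide_eq mult_left_le)
    ultimately show ?thesis using low[of 1 1] LK K by linarith
  qed
  have d1: "K \<le> real r ^ 2 * q"
  proof -
    have "K \<le> T / 18" using nK T K by linarith
    also have "\<dots> = (?n / 3) ^ 2 * (T / (2 * ?n ^ 2))" using n0 by (simp add: field_simps)
    also have "\<dots> \<le> real r ^ 2 * q" using r1 qT T0 n0 by (intro mult_mono power_mono) auto
    finally show ?thesis .
  qed
  have d2: "K \<le> real r ^ 3 * q ^ 2"
  proof -
    have "K * (108 * ?n) \<le> ?n * ?n" using nK n0 by simp
    also have "\<dots> \<le> T * T" using T n0 by (intro mult_mono) auto
    finally have "K \<le> T ^ 2 / (108 * ?n)" using n0 by (simp add: pos_le_divide_eq power2_eq_square)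
    also have "\<dots> = (?n / 3) ^ 3 * (T / (2 * ?n ^ 2)) ^ 2" using n0 by (simp add: field_simps eval_nat_numeral)
    also have "\<dots> \<le> real r ^ 3 * q ^ 2" using r1 qT T0 n0 q by (intro mult_mono power_mono) auto
    finally show ?thesis .
  qed
  \<comment> \<open>The 128 in the hypothesis is 32 from the fifth power of \<open>2\<close> times
    4, so that \<open>L / w \<le> n / 4\<close>, hence \<open>k \<le> n / 2\<close>.\<close>
  have fit: "k + r \<le> n"
  proof -
    have "L / w \<le> L / (?n ^ 3 * (T / (2 * ?n ^ 2)) ^ 5)"
      unfolding w_def using qT T0 n0 L0 q by (intro divide_left_mono mult_left_mono power_mono) auto
    also have "\<dots> = (32 * L * ?n ^ 6) * ?n / T ^ 5"
      using n0 T0 by (simp add: field_simps eval_nat_numeral)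
    also have "\<dots> \<le> (T ^ 5 / 4) * ?n / T ^ 5"
      using T T0 n0 by (intro divide_right_mono mult_right_mono) auto
    finally have "L / w \<le> ?n / 4" using T0 by simp
    hence "real k + real r \<le> ?n" using k2 r2 by linarith
    thus ?thesis by linarith
  qed
  \<comment> \<open>Spokes cost at most \<open>2 * L / (n^2 q^4)\<close>, closing edges that times
    \<open>n * q^2\<close>; each is at most \<open>32 * L * n^6 / T^4\<close>.\<close>
  have budget: "real k * real r * q + real k * real r ^ 2 * q ^ 3 \<le> 64 * L * (?n ^ 6 / T ^ 4)"
  proof -
    have "2 * (L / w) * (?n ^ 1 * q ^ 1) = 2 * L / (?n ^ 2 * q ^ 4)"
      using n0 q by (simp add: w_def field_simps eval_nat_numeral)
    hence 1: "real k * (real r ^ 1 * q ^ 1) \<le> 2 * L / (?n ^ 2 * q ^ 4)" using up[of 1 1] by linarith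
    have "2 * (L / w) * (?n ^ 2 * q ^ 3) = 2 * L / (?n ^ 2 * q ^ 4) * (?n * q ^ 2)"
      using n0 q by (simp add: w_def field_simps eval_nat_numeral)
    also have "\<dots> \<le> 2 * L / (?n ^ 2 * q ^ 4)" using nq2 n0 q L0 by (intro mult_left_le) auto
    finally have 2: "real k * (real r ^ 2 * q ^ 3) \<le> 2 * L / (?n ^ 2 * q ^ 4)" using up[of 2 3] by linarith
    have "2 * L / (?n ^ 2 * q ^ 4) \<le> 2 * L / (?n ^ 2 * (T / (2 * ?n ^ 2)) ^ 4)"
      using qT T0 n0 L0 q by (intro divide_left_mono mult_left_mono power_mono) auto
    also have "\<dots> = 32 * L * (?n ^ 6 / T ^ 4)" using n0 T0 by (simp add: field_simps eval_nat_numeral)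
    finally show ?thesis using 1 2 by (simp add: mult.assoc)
  qed
  show ?thesis
    using fit budget c1 c3 c5 d1 d2 r1 nK K by (intro exI[of _ k] exI[of _ r]) (auto simp: mult.assoc)
qed

text \<open>A non-asymptotic form: one parameter \<open>K\<close> controls all losses, and the
  guaranteed probability tends to 1 as \<open>K\<close> grows.\<close>

lemma exists_good_strategy_of_parameter:
  fixes K L :: real
  assumes K: "K \<ge> 4" and L: "L = (4 * K) ^ 4" and tN: "t \<le> n choose 2"
    and n: "(4 * K) ^ 6 \<le> real n" and t: "128 * L * real n ^ 6 \<le> real t ^ 5"
    and b: "64 * K * L * b_star n t \<le> real b"
  shows "\<exists>B. is_strategy n t b B \<and> (1 - 3 / K) * (1 - 1 / K) / (1 + 108 / K) - 1 / K \<le> prob_K4_minus n t B"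
proof -
  define m where "m = t div 2"
  define q where "q = real m / (real (n choose 2) - 10)"
  have K6: "1000 * K \<le> real n"
  proof -
    have "1000 * K \<le> 4096 * K * 1" using K by simp
    also have "\<dots> \<le> 4096 * K * K ^ 5" using K by (intro mult_left_mono) auto
    also have "\<dots> = (4 * K) ^ 6" by (simp add: power_mult_distrib eval_nat_numeral)
    finally show ?thesis using n by linarith
  qed
  have n0: "real n \<ge> 4000" using K6 K by linarith
  have L1: "L \<ge> 1" unfolding L using K by (intro one_le_power) auto
  have LK: "K ^ 2 \<le> L"
  proof -
    have "K ^ 2 \<le> (4 * K) ^ 2" using K by (intro power_mono) auto
    also have "\<dots> \<le> L" unfolding L using K by (intro power_increasing) auto
    finally show ?thesis .
  qed
  have tn: "real n \<le> real t"
  proof -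
    have "real n ^ 5 \<le> real n ^ 6" using n0 by (intro power_increasing) auto
    also have "\<dots> \<le> 128 * L * real n ^ 6" using L1 by (simp add: mult_le_cancel_right1)
    also note t
    finally show ?thesis by (subst (asm) power_mono_iff) auto
  qed
  have N: "real n * 1000 \<le> real (n choose 2)"
  proof -
    have "real n * 1000 \<le> real n ^ 2 / 4" using n0 by (simp add: power2_eq_square)
    also have "\<dots> \<le> real (n choose 2)" using n0 by (intro choose_two_bounds) linarith
    finally show ?thesis .
  qed
  have m2: "2 * m \<le> t" "t \<le> 2 * m + 1" unfolding m_def by linarith+
  have mK: "400 * K \<le> real m" using m2 tn K6 K by linarith
  have m_pos: "real m > 0" using mK K by linarith
  have N10: "real (n choose 2) - 10 > 0" using N n0 by linarith
  have q0: "q > 0" unfolding q_def using m_pos N10 by simp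
  have q1: "q \<le> 1"
  proof -
    have "real m \<le> real (n choose 2) - 10" using m2 tN N n0 by linarith
    thus ?thesis unfolding q_def using N10 by simp
  qed
  have tq: "real t \<le> 2 * (q * real n ^ 2)"
  proof -
    have "real t * (real (n choose 2) - 10) \<le> real t * (real n ^ 2 / 2)"
      using choose_two_bounds(2)[of n] by (intro mult_left_mono) auto
    also have "\<dots> \<le> (4 * real m) * (real n ^ 2 / 2)"
      using m2 m_pos mK K by (intro mult_right_mono) auto
    finally show ?thesis unfolding q_def using N10 by (simp add: field_simps)
  qed
  have bs0: "b_star n t > 0" using n0 tn by (auto simp: b_star_def less_max_iff_disj)
  have b_pos: "b > 0"
  proof -
    have "0 < 64 * K * L * b_star n t" using bs0 K L1 by (intro mult_pos_pos) auto
    thus ?thesis using b by linarith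
  qed
  have exists: "\<exists>k r. k + r \<le> n \<and> K \<le> real r \<and> K \<le> real k * real r * q \<and> K \<le> real k * real r ^ 2 * q ^ 3 \<and>
     K \<le> real k * real r ^ 3 * q ^ 5 \<and> K \<le> real r ^ 2 * q \<and> K \<le> real r ^ 3 * q ^ 2 \<and>
     real k * real r * q + real k * real r ^ 2 * q ^ 3 \<le> 64 * L * b_star n t"
  proof -
    define u where "u = q powr (-1/3)"
    have u: "q * u ^ 3 = 1" unfolding u_def using q0 by (simp add: powr_minus_divide power_divide powr_power)
    have u1: "u \<ge> 1"
    proof (rule ccontr)
      assume "\<not> u \<ge> 1"
      moreover have "u > 0" unfolding u_def using q0 by simp
      ultimately have "u ^ 3 < 1" by (intro power_less_one_iff[THEN iffD2]) auto
      hence "q * u ^ 3 < q * 1" using q0 by (intro mult_strict_left_mono)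
      thus False using u q1 by simp
    qed
    show ?thesis
    \<comment> \<open>The dichotomy between the two terms of \<open>b_star\<close>: does a star with
      about \<open>K * q^(-5/3)\<close> leaves fit into the vertex set?\<close>
    proof (cases "4 * (K * u ^ 5) \<le> real n")
      case True
      let ?\<beta> = "real n powr (4/3) / real t powr (2/3)"
      have \<beta>3: "?\<beta> ^ 3 = real n ^ 4 / real t ^ 2"
        using n0 tn by (simp add: power_divide powr_power)
      \<comment> \<open>From \<open>u ^ 3 = 1 / q \<le> 2 * n ^ 2 / t\<close>; squaring gives
        \<open>4 * ?\<beta> ^ 3\<close>, and 4 is relaxed to the cube 8.\<close>
      have "u ^ 2 \<le> 2 * ?\<beta>"
      proof -
        have "u ^ 3 \<le> 2 * real n ^ 2 / real t"
        proof -
          have "real t * u ^ 3 \<le> 2 * (q * real n ^ 2) * u ^ 3" using tq u1 by (intro mult_right_mono) auto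
          also have "\<dots> = 2 * real n ^ 2 * (q * u ^ 3)" by (simp add: mult_ac)
          finally show ?thesis using u tn n0 by (simp add: pos_le_divide_eq mult.commute)
        qed
        hence "(u ^ 3) ^ 2 \<le> (2 * real n ^ 2 / real t) ^ 2" using u1 by (intro power_mono) auto
        also have "\<dots> = 4 * ?\<beta> ^ 3" unfolding \<beta>3 by (simp add: power_divide power_mult_distrib flip: power_mult)
        also have "\<dots> \<le> 8 * ?\<beta> ^ 3" by (intro mult_right_mono) auto
        also have "\<dots> = (2 * ?\<beta>) ^ 3" unfolding power_mult_distrib by simp
        finally have "(u ^ 2) ^ 3 \<le> (2 * ?\<beta>) ^ 3" by (simp flip: power_mult)
        thus ?thesis by (subst (asm) power_mono_iff) auto
      qed
      then obtain r where r: "1 + r \<le> n" "K \<le> real r" "K \<le> real r * q" "K \<le> real r ^ 2 * q ^ 3"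
        "K \<le> real r ^ 3 * q ^ 5" "K \<le> real r ^ 2 * q" "K \<le> real r ^ 3 * q ^ 2"
        "real r * q + real r ^ 2 * q ^ 3 \<le> 12 * K ^ 2 * ?\<beta>"
        using dense_parameters[OF K u1 u True] by blast
      have "12 * K ^ 2 * ?\<beta> \<le> 64 * L * b_star n t"
        using LK L1 by (intro mult_mono) (auto simp: b_star_def)
      thus ?thesis using r by (intro exI[of _ 1] exI[of _ r]) auto
    next
      case False
      have "real n ^ 3 * q ^ 5 \<le> (4 * (K * u ^ 5)) ^ 3 * q ^ 5"
        using False q0 by (intro mult_right_mono power_mono) auto
      also have "\<dots> = (4 * K) ^ 3 * (q * u ^ 3) ^ 5" by (simp add: power_mult_distrib flip: power_mult)
      finally have "real n ^ 3 * q ^ 5 \<le> (4 * K) ^ 3" using u by simp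
      then obtain k r where kr: "k + r \<le> n" "K \<le> real r" "K \<le> real k * real r * q" "K \<le> real k * real r ^ 2 * q ^ 3"
        "K \<le> real k * real r ^ 3 * q ^ 5" "K \<le> real r ^ 2 * q" "K \<le> real r ^ 3 * q ^ 2"
        "real k * real r * q + real k * real r ^ 2 * q ^ 3 \<le> 64 * L * (real n ^ 6 / real t ^ 4)"
        using sparse_parameters[OF K L q0 n _ tq t tn] by blast
      have "64 * L * (real n ^ 6 / real t ^ 4) \<le> 64 * L * b_star n t"
        using L1 by (intro mult_left_mono) (auto simp: b_star_def)
      thus ?thesis using kr by (intro exI[of _ k] exI[of _ r]) auto
    qed
  qed
  then obtain k r where kr: "k + r \<le> n" "K \<le> real r" "K \<le> real k * real r * q" "K \<le> real k * real r ^ 2 * q ^ 3"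
     "K \<le> real k * real r ^ 3 * q ^ 5" "K \<le> real r ^ 2 * q" "K \<le> real r ^ 3 * q ^ 2"
     "real k * real r * q + real k * real r ^ 2 * q ^ 3 \<le> 64 * L * b_star n t" by blast
  interpret tp: two_phase n m k r
    by unfold_locales (use kr m2 tN mK K N n0 in linarith)+
  have qq: "tp.q = q" by (simp add: tp.q_def q_def)
  have "K * (real k * real r * q + real k * real r ^ 2 * q ^ 3) \<le> K * (64 * L * b_star n t)"
    using kr(8) K by (intro mult_left_mono) auto
  hence bud: "K * (real k * real r * q + real k * real r ^ 2 * q ^ 3) \<le> real b" using b by (simp add: mult_ac)
  obtain B where B: "is_strategy n t b B"
    "(1 - 3 / K) * ((real m - 3) / real (n choose 2) / q) ^ 10 / (1 + 108 / K) - 1 / K \<le> prob_K4_minus n t B"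
    using tp.exists_good_strategy[of K t b] kr K m2 b_pos bud unfolding qq by auto
  \<comment> \<open>The ratio of the lower to the upper base is
    \<open>(1 - 3/m) * (1 - 10/N)\<close> with \<open>N\<close> the number of edges. Bernoulli's
    inequality handles the tenth power, which comes from squaring five edges.\<close>
  have "1 - 1 / K \<le> ((real m - 3) / real (n choose 2) / q) ^ 10"
  proof -
    define \<delta> where "\<delta> = 3 / real m + 10 / real (n choose 2)"
    have "3 / real m \<le> 3 / (400 * K)" using mK K by (intro divide_left_mono) auto
    hence 1: "3 / real m \<le> 3 / 400 * (1 / K)" by simp
    have "1000 * K \<le> real (n choose 2)" using N K6 K by linarith
    hence "10 / real (n choose 2) \<le> 10 / (1000 * K)" using K by (intro frac_le) auto
    hence 2: "10 / real (n choose 2) \<le> 1 / 100 * (1 / K)" by simp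
    have "10 * (x + y) \<le> z" if "x \<le> 3 / 400 * z" "y \<le> 1 / 100 * z" "0 \<le> z" for x y z :: real
      using that by (simp add: field_simps)
    from this[OF 1 2] have \<delta>: "10 * \<delta> \<le> 1 / K" using K by (simp add: \<delta>_def)
    have "1 / K \<le> 1" using K by simp
    hence \<delta>1: "\<delta> \<le> 1" using \<delta> by linarith
    have "(real m - 3) / real (n choose 2) / q
       = ((real m - 3) / real m) * ((real (n choose 2) - 10) / real (n choose 2))"
      by (simp add: q_def)
    also have "\<dots> = (1 - 3 / real m) * (1 - 10 / real (n choose 2))"
      using m_pos n0 by (simp add: diff_divide_distrib)
    also have "\<dots> = 1 - \<delta> + 3 / real m * (10 / real (n choose 2))"
    proof -
      have "(1 - x) * (1 - y) = 1 - (x + y) + x * y" for x y :: real by (simp add: algebra_simps)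
      thus ?thesis unfolding \<delta>_def .
    qed
    finally have ge: "1 - \<delta> \<le> (real m - 3) / real (n choose 2) / q" using m_pos N10 by simp
    have "1 - 1 / K \<le> 1 + real 10 * (- \<delta>)" using \<delta> by simp
    also have "\<dots> \<le> (1 + (- \<delta>)) ^ 10" using \<delta>1 by (intro Bernoulli_inequality) auto
    also have "\<dots> \<le> ((real m - 3) / real (n choose 2) / q) ^ 10" using ge \<delta>1 by (intro power_mono) auto
    finally show ?thesis .
  qed
  hence "(1 - 3 / K) * (1 - 1 / K) / (1 + 108 / K) \<le> (1 - 3 / K) * ((real m - 3) / real (n choose 2) / q) ^ 10 / (1 + 108 / K)"
    using K by (intro divide_right_mono mult_left_mono) auto
  thus ?thesis using B by (intro exI[of _ B]) auto
qed

section \<open>Passing to the limit\<close>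

lemma eventually_exists_good_strategy:
  fixes \<epsilon> :: real
  assumes "eventually (\<lambda>n. t n \<le> n choose 2) sequentially" "\<epsilon> > 0"
    and "little_omega (\<lambda>n. real (t n)) (\<lambda>n. real n powr (6/5))"
    and "little_omega (\<lambda>n. real (b n)) (\<lambda>n. b_star n (t n))"
  shows "eventually (\<lambda>n. \<exists>B. is_strategy n (t n) (b n) B \<and> 1 - \<epsilon> \<le> prob_K4_minus n (t n) B) sequentially"
proof -
  have "((\<lambda>K::real. (1 - 3 / K) * (1 - 1 / K) / (1 + 108 / K) - 1 / K) \<longlongrightarrow> (1 - 0) * (1 - 0) / (1 + 0) - 0) at_top"
    by (intro tendsto_intros tendsto_divide_0[OF tendsto_const] filterlim_at_top_imp_at_infinity filterlim_ident) auto
  hence "eventually (\<lambda>K::real. 1 - \<epsilon> < (1 - 3 / K) * (1 - 1 / K) / (1 + 108 / K) - 1 / K) at_top"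
    using assms(2) by (intro order_tendstoD(1)) auto
  hence "eventually (\<lambda>K::real. K \<ge> 4 \<and> 1 - \<epsilon> < (1 - 3 / K) * (1 - 1 / K) / (1 + 108 / K) - 1 / K) at_top"
    by (rule eventually_conj[OF eventually_ge_at_top])
  then obtain K :: real where K: "K \<ge> 4" "1 - \<epsilon> < (1 - 3 / K) * (1 - 1 / K) / (1 + 108 / K) - 1 / K"
    using eventually_happens'[OF trivial_limit_at_top_linorder] by blast
  define L where "L = (4 * K) ^ 4"
  have L1: "L \<ge> 1" unfolding L_def using K by (intro one_le_power) auto
  have "eventually (\<lambda>n. 128 * L \<le> real (t n) / real n powr (6/5)) sequentially"
    using assms(3) unfolding little_omega_def filterlim_at_top by blast
  moreover have "eventually (\<lambda>n. 64 * K * L \<le> real (b n) / b_star n (t n)) sequentially"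
    using assms(4) unfolding little_omega_def filterlim_at_top by blast
  moreover have "eventually (\<lambda>n. (4 * K) ^ 6 \<le> real n) sequentially"
    using filterlim_real_sequentially unfolding filterlim_at_top by blast
  ultimately show ?thesis using assms(1)
  proof eventually_elim
    case (elim n)
    have "(4 * K) ^ 6 > 0" using K by simp
    hence n0: "real n > 0" using elim(3) by linarith
    have tge: "128 * L * real n powr (6/5) \<le> real (t n)"
      using elim(1) n0 by (simp add: pos_le_divide_eq)
    have t0: "real (t n) > 0"
    proof -
      have "0 < 128 * L * real n powr (6/5)" using L1 n0 by (intro mult_pos_pos) auto
      thus ?thesis using tge by linarith
    qed
    \<comment> \<open>As \<open>128 * L \<ge> 1\<close>, raising it to the fifth power only
      helps.\<close>
    have "128 * L * real n ^ 6 \<le> (128 * L) ^ 5 * real n ^ 6"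
      using L1 by (intro mult_right_mono self_le_power) auto
    also have "\<dots> = (128 * L * real n powr (6/5)) ^ 5"
      using n0 by (simp add: power_mult_distrib powr_power)
    also have "\<dots> \<le> real (t n) ^ 5" using tge L1 by (intro power_mono) auto
    finally have t5: "128 * L * real n ^ 6 \<le> real (t n) ^ 5" .
    have "b_star n (t n) > 0" using n0 t0 by (auto simp: b_star_def less_max_iff_disj)
    hence "64 * K * L * b_star n (t n) \<le> real (b n)"
      using elim(2) by (simp add: pos_le_divide_eq)
    from exists_good_strategy_of_parameter[OF K(1) L_def elim(4) elim(3) t5 this]
    show ?case using K(2) by (metis less_eq_real_def order_trans)
  qed
qed

text \<open>Makes the set of attainable probabilities nonempty for every \<open>n\<close>, including
  the small ones.\<close>

lemma exists_strategy: "\<exists>B. is_strategy n t b B"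
  using exists_strategy_selecting[of n t b] by blast

text \<open>The good strategies depend on the tolerance, but one sequence must serve all tolerances.
  Choosing for every \<open>n\<close> a strategy within \<open>1 / (n + 1)\<close> of the supremum
  removes the dependence.\<close>

lemma exists_strategies_tendsto_1:
  assumes "eventually (\<lambda>n. t n \<le> n choose 2) sequentially"
    and "little_omega (\<lambda>n. real (t n)) (\<lambda>n. real n powr (6/5))"
    and "little_omega (\<lambda>n. real (b n)) (\<lambda>n. b_star n (t n))"
  shows "\<exists>B :: nat \<Rightarrow> rule. (\<forall>n. is_strategy n (t n) (b n) (B n)) \<and> (\<lambda>n. prob_K4_minus n (t n) (B n)) \<longlonglongrightarrow> 1"
proof -
  have le1: "prob_K4_minus n t B \<le> 1" for n t B by (simp add: prob_K4_minus_def)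
  define P where "P n = {prob_K4_minus n (t n) B |B. is_strategy n (t n) (b n) B}" for n
  have bdd: "bdd_above (P n)" for n by (rule bdd_aboveI[of _ 1]) (auto simp: P_def le1)
  have "\<exists>B. is_strategy n (t n) (b n) B \<and> Sup (P n) - 1 / real (Suc n) < prob_K4_minus n (t n) B" for n
  proof -
    have "P n \<noteq> {}" using exists_strategy by (auto simp: P_def)
    then obtain y where "y \<in> P n" "Sup (P n) - 1 / real (Suc n) < y"
      using less_cSup_iff[OF _ bdd, of n "Sup (P n) - 1 / real (Suc n)"] by auto
    thus ?thesis by (auto simp: P_def)
  qed
  then obtain B where B: "\<And>n. is_strategy n (t n) (b n) (B n)"
    "\<And>n. Sup (P n) - 1 / real (Suc n) < prob_K4_minus n (t n) (B n)" by metis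
  have "(\<lambda>n. prob_K4_minus n (t n) (B n)) \<longlonglongrightarrow> 1"
  proof (rule order_tendstoI)
    fix a :: real assume "a < 1"
    \<comment> \<open>Half of the gap is spent on the quality of the strategy, half on the distance
      to the supremum.\<close>
    define \<epsilon> where "\<epsilon> = (1 - a) / 2"
    have \<epsilon>: "\<epsilon> > 0" using \<open>a < 1\<close> by (simp add: \<epsilon>_def)
    have "eventually (\<lambda>n. 1 / real (Suc n) < \<epsilon>) sequentially"
      using lim_inverse_n' \<epsilon> LIMSEQ_Suc[OF lim_inverse_n'] by (intro order_tendstoD(2)) auto
    with eventually_exists_good_strategy[OF assms(1) \<epsilon> assms(2,3)]
    show "eventually (\<lambda>n. a < prob_K4_minus n (t n) (B n)) sequentially"
    proof eventually_elim
      case (elim n)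
      then obtain B' where "is_strategy n (t n) (b n) B'" "1 - \<epsilon> \<le> prob_K4_minus n (t n) B'" by blast
      hence "1 - \<epsilon> \<le> Sup (P n)" by (intro cSup_upper2[OF _ _ bdd]) (auto simp: P_def)
      moreover have "a = 1 - 2 * \<epsilon>" by (simp add: \<epsilon>_def field_simps)
      ultimately show ?case using B(2)[of n] elim(2) by linarith
    qed
  next
    fix a :: real assume "1 < a"
    thus "eventually (\<lambda>n. prob_K4_minus n (t n) (B n) < a) sequentially"
      using le1 by (intro always_eventually allI) (meson le_less_trans)
  qed
  thus ?thesis using B(1) by blast
qed

theorem theorem1p3:
  fixes t b :: "nat \<Rightarrow> nat"
  assumes "eventually (\<lambda>n. t n \<le> n choose 2) sequentially"
  shows "(little_omega (\<lambda>n. real (t n)) (\<lambda>n. real n powr (6/5)) \<and>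
          little_omega (\<lambda>n. real (b n)) (\<lambda>n. b_star n (t n)) \<longrightarrow>
            (\<exists>B :: nat \<Rightarrow> rule. (\<forall>n. is_strategy n (t n) (b n) (B n)) \<and>
                 (\<lambda>n. prob_K4_minus n (t n) (B n)) \<longlonglongrightarrow> 1)) \<and>
         (little_o (\<lambda>n. real (t n)) (\<lambda>n. real n powr (6/5)) \<or>
          little_o (\<lambda>n. real (b n)) (\<lambda>n. b_star n (t n)) \<longrightarrow>
            (\<forall>B :: nat \<Rightarrow> rule. (\<forall>n. is_strategy n (t n) (b n) (B n)) \<longrightarrow>
                 (\<lambda>n. prob_K4_minus n (t n) (B n)) \<longlonglongrightarrow> 0))"
  using exists_strategies_tendsto_1[OF assms] prob_K4_minus_tendsto_0[OF assms] by blast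

end
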